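(* Let $a,b,c,d\in\mathbb{R}$ satisfy $ad=bc$. Let $G$ be a three-dimensional real connected Lie group whose Lie algebra has a global basis of left-invariant vector fields $\{e_0,e_1,e_2\}$ with non-zero commutators $$[e_0,e_1]=-d\,e_0,\qquad [e_0,e_2]=c\,e_0,\qquad [e_1,e_2]=a\,e_1+b\,e_2 .$$ Equip $G$ with the left-invariant almost contact B-metric structure $(\varphi,\xi,\eta,g)$ given by $$\varphi e_0=0,\quad \varphi e_1=e_2,\quad \varphi e_2=-e_1,\quad \xi=e_0,\quad \eta(e_0)=1,\quad \eta(e_1)=\eta(e_2)=0,$$ $$g(e_0,e_0)=g(e_1,e_1)=-g(e_2,e_2)=1,\qquad g(e_0,e_1)=g(e_0,e_2)=g(e_1,e_2)=0 .$$ Then $(G,\varphi,\xi,\eta,g)$ belongs to the class $\mathcal{F}_1\oplus\mathcal{F}_{11}$.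
   Context: An almost contact B-metric manifold $(M,\varphi,\xi,\eta,g)$ is a $(2n+1)$-dimensional manifold with a $(1,1)$-tensor field $\varphi$, a vector field $\xi$ and a 1-form $\eta$ such that $\varphi\xi=0$, $\varphi^2=-\mathrm{Id}+\eta\otimes\xi$, $\eta\circ\varphi=0$, $\eta(\xi)=1$, and a pseudo-Riemannian metric $g$ such that $g(\varphi x,\varphi y)=-g(x,y)+\eta(x)\eta(y)$. Let $\nabla$ be the Levi-Civita connection of $g$ and define the $(0,3)$-tensor $F(x,y,z)=g((\nabla_x\varphi)y,z)$. In dimension 3, let $\{e_0=\xi,e_1,e_2\}$ be a basis with $\varphi e_1=e_2$, $\varphi e_2=-e_1$, $g(e_0,e_0)=g(e_1,e_1)=-g(e_2,e_2)=1$ and $g(e_i,e_j)=0$ for $i\neq j$. Write $x=x^ie_i$, $y=y^ie_i$, $z=z^ie_i$ and $F_{ijk}=F(e_i,e_j,e_k)$. The manifold belongs to the class $\mathcal{F}_1\oplus\mathcal{F}_{11}$ if $F=F^1+F^{11}$, where $$F^{1}(x,y,z)=(x^1\theta_1-x^2\theta_2)(y^1z^1+y^2z^2),\qquad \theta_1=F_{111}=F_{122},\quad \theta_2=-F_{211}=-F_{222},$$ $$F^{11}(x,y,z)=x^0\{(y^1z^0+y^0z^1)\omega_1+(y^2z^0+y^0z^2)\omega_2\},\qquad \omega_1=F_{010}=F_{001},\quad \omega_2=F_{020}=F_{002}.$$ *)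

theory Defs
  imports "HOL-Analysis.Analysis" "HOL-Algebra.Group"
begin

section \<open>Smooth manifolds\<close>

text \<open>Membership in $C^k$, resp.\ $C^\infty$, on an open subset of a Euclidean space.\<close>

primrec Ck_on :: "nat \<Rightarrow> 'e::euclidean_space set \<Rightarrow> ('e \<Rightarrow> 'f::real_normed_vector) \<Rightarrow> bool" where
  "Ck_on 0 S f \<longleftrightarrow> continuous_on S f"
| "Ck_on (Suc k) S f \<longleftrightarrow> (\<forall>x\<in>S. f differentiable (at x)) \<and>
      (\<forall>w. Ck_on k S (\<lambda>x. frechet_derivative f (at x) w))"

definition smooth_on :: "'e::euclidean_space set \<Rightarrow> ('e \<Rightarrow> 'f::real_normed_vector) \<Rightarrow> bool" where
  "smooth_on S f \<longleftrightarrow> (\<forall>k. Ck_on k S f)"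

text \<open>A chart is a pair of its domain and its coordinate map. Points are the elements of
  the topological space, not of the whole type; values of coordinate maps and of real
  functions outside it are irrelevant.\<close>

record ('a, 'e) manifold =
  mtop :: "'a topology"
  charts :: "('a set \<times> ('a \<Rightarrow> 'e)) set"

abbreviation points :: "('a, 'e) manifold \<Rightarrow> 'a set" where
  "points M \<equiv> topspace (mtop M)"

definition smooth_manifold :: "('a, 'e::euclidean_space) manifold \<Rightarrow> bool" where
  "smooth_manifold M \<longleftrightarrow>
     Hausdorff_space (mtop M) \<and> second_countable (mtop M) \<and>
     \<Union> (fst ` charts M) = points M \<and>
     (\<forall>(U, c) \<in> charts M. openin (mtop M) U \<and> open (c ` U) \<and>
        homeomorphic_map (subtopology (mtop M) U) (top_of_set (c ` U)) c) \<and>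
     (\<forall>(U, c) \<in> charts M. \<forall>(V, d) \<in> charts M.
        smooth_on (c ` (U \<inter> V)) (d \<circ> inv_into U c))"

definition smooth_map ::
    "('a, 'e::euclidean_space) manifold \<Rightarrow> ('b, 'f::euclidean_space) manifold \<Rightarrow> ('a \<Rightarrow> 'b) \<Rightarrow> bool" where
  "smooth_map M N h \<longleftrightarrow> continuous_map (mtop M) (mtop N) h \<and>
     (\<forall>(U, c) \<in> charts M. \<forall>(V, d) \<in> charts N.
        smooth_on (c ` {q \<in> U. h q \<in> V}) (d \<circ> h \<circ> inv_into U c))"

definition prod_manifold ::
    "('a, 'e) manifold \<Rightarrow> ('b, 'f) manifold \<Rightarrow> ('a \<times> 'b, 'e \<times> 'f) manifold" where
  "prod_manifold M N = \<lparr> mtop = prod_topology (mtop M) (mtop N),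
     charts = {(U \<times> V, map_prod c d) | U c V d. (U, c) \<in> charts M \<and> (V, d) \<in> charts N} \<rparr>"

definition smooth_fun_on :: "('a, 'e::euclidean_space) manifold \<Rightarrow> 'a set \<Rightarrow> ('a \<Rightarrow> real) \<Rightarrow> bool" where
  "smooth_fun_on M W f \<longleftrightarrow> openin (mtop M) W \<and>
     (\<forall>(U, c) \<in> charts M. smooth_on (c ` (U \<inter> W)) (f \<circ> inv_into U c))"

definition smooth_near :: "('a, 'e::euclidean_space) manifold \<Rightarrow> 'a \<Rightarrow> ('a \<Rightarrow> real) \<Rightarrow> bool" where
  "smooth_near M p f \<longleftrightarrow> (\<exists>W. p \<in> W \<and> smooth_fun_on M W f)"


section \<open>Tangent vectors and vector fields\<close>

text \<open>A tangent vector at \<open>p\<close> is a combination of the coordinate derivatives at \<open>p\<close>, regarded as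
  an operator on the functions that are smooth near \<open>p\<close>. It is extended by 0 to all other
  functions, so that equality of tangent vectors is equality of operators.\<close>

type_synonym 'a tvec = "('a \<Rightarrow> real) \<Rightarrow> real"
type_synonym 'a vfield = "'a \<Rightarrow> 'a tvec"

definition tangent_space :: "('a, 'e::euclidean_space) manifold \<Rightarrow> 'a \<Rightarrow> 'a tvec set" where
  "tangent_space M p = {v. \<exists>(U, c) \<in> charts M. p \<in> U \<and>
     (\<exists>w. \<forall>f. v f = (if smooth_near M p f
                     then frechet_derivative (f \<circ> inv_into U c) (at (c p)) w else 0))}"

text \<open>Smooth vector fields are normalised to be 0 outside the points of the manifold.\<close>

definition vfields :: "('a, 'e::euclidean_space) manifold \<Rightarrow> 'a vfield set" where
  "vfields M = {X. (\<forall>p \<in> points M. X p \<in> tangent_space M p) \<and>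
     (\<forall>p. p \<notin> points M \<longrightarrow> X p = (\<lambda>f. 0)) \<and>
     (\<forall>W f. smooth_fun_on M W f \<longrightarrow> smooth_fun_on M W (\<lambda>p. X p f))}"

definition lie_bracket :: "('a, 'e::euclidean_space) manifold \<Rightarrow> 'a vfield \<Rightarrow> 'a vfield \<Rightarrow> 'a vfield" where
  "lie_bracket M X Y = (\<lambda>p f. if smooth_near M p f
     then X p (\<lambda>q. Y q f) - Y p (\<lambda>q. X q f) else 0)"

definition tbasis :: "('a, 'e::euclidean_space) manifold \<Rightarrow> 'a \<Rightarrow> (nat \<Rightarrow> 'a tvec) \<Rightarrow> bool" where
  "tbasis M p u \<longleftrightarrow> (\<forall>i<3. u i \<in> tangent_space M p) \<and>
     (\<forall>v \<in> tangent_space M p. \<exists>x. v = (\<lambda>f. \<Sum>i<3. x i * u i f)) \<and>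
     (\<forall>x. (\<forall>f. (\<Sum>i<3. x i * u i f) = 0) \<longrightarrow> (\<forall>i<3. x i = 0))"


section \<open>Tensor fields\<close>

definition one_form :: "('a, 'e::euclidean_space) manifold \<Rightarrow> ('a \<Rightarrow> 'a tvec \<Rightarrow> real) \<Rightarrow> bool" where
  "one_form M \<eta> \<longleftrightarrow>
     (\<forall>p \<in> points M. \<forall>v \<in> tangent_space M p. \<forall>w \<in> tangent_space M p. \<forall>r s.
        \<eta> p (\<lambda>f. r * v f + s * w f) = r * \<eta> p v + s * \<eta> p w) \<and>
     (\<forall>X \<in> vfields M. smooth_fun_on M (points M) (\<lambda>p. \<eta> p (X p)))"

definition app11 :: "('a, 'e) manifold \<Rightarrow> ('a \<Rightarrow> 'a tvec \<Rightarrow> 'a tvec) \<Rightarrow> 'a vfield \<Rightarrow> 'a vfield" where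
  "app11 M \<phi> X = (\<lambda>p. if p \<in> points M then \<phi> p (X p) else (\<lambda>f. 0))"

definition tensor11 :: "('a, 'e::euclidean_space) manifold \<Rightarrow> ('a \<Rightarrow> 'a tvec \<Rightarrow> 'a tvec) \<Rightarrow> bool" where
  "tensor11 M \<phi> \<longleftrightarrow>
     (\<forall>p \<in> points M. \<forall>v \<in> tangent_space M p. \<phi> p v \<in> tangent_space M p) \<and>
     (\<forall>p \<in> points M. \<forall>v \<in> tangent_space M p. \<forall>w \<in> tangent_space M p. \<forall>r s.
        \<phi> p (\<lambda>f. r * v f + s * w f) = (\<lambda>f. r * \<phi> p v f + s * \<phi> p w f)) \<and>
     (\<forall>X \<in> vfields M. app11 M \<phi> X \<in> vfields M)"

definition symmetric_tensor02 ::
    "('a, 'e::euclidean_space) manifold \<Rightarrow> ('a \<Rightarrow> 'a tvec \<Rightarrow> 'a tvec \<Rightarrow> real) \<Rightarrow> bool" where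
  "symmetric_tensor02 M g \<longleftrightarrow>
     (\<forall>p \<in> points M. \<forall>u \<in> tangent_space M p. \<forall>v \<in> tangent_space M p. g p u v = g p v u) \<and>
     (\<forall>p \<in> points M. \<forall>u \<in> tangent_space M p. \<forall>v \<in> tangent_space M p.
        \<forall>w \<in> tangent_space M p. \<forall>r s.
        g p (\<lambda>f. r * v f + s * w f) u = r * g p v u + s * g p w u) \<and>
     (\<forall>X \<in> vfields M. \<forall>Y \<in> vfields M. smooth_fun_on M (points M) (\<lambda>p. g p (X p) (Y p)))"

definition pseudo_riemannian ::
    "('a, 'e::euclidean_space) manifold \<Rightarrow> ('a \<Rightarrow> 'a tvec \<Rightarrow> 'a tvec \<Rightarrow> real) \<Rightarrow> bool" where
  "pseudo_riemannian M g \<longleftrightarrow> symmetric_tensor02 M g \<and>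
     (\<forall>p \<in> points M. \<forall>u \<in> tangent_space M p.
        (\<forall>v \<in> tangent_space M p. g p u v = 0) \<longrightarrow> u = (\<lambda>f. 0))"


section \<open>The Levi-Civita connection\<close>

definition affine_connection ::
    "('a, 'e::euclidean_space) manifold \<Rightarrow> ('a vfield \<Rightarrow> 'a vfield \<Rightarrow> 'a vfield) \<Rightarrow> bool" where
  "affine_connection M D \<longleftrightarrow>
     (\<forall>X \<in> vfields M. \<forall>Y \<in> vfields M. D X Y \<in> vfields M) \<and>
     (\<forall>X \<in> vfields M. \<forall>Y \<in> vfields M. \<forall>Z \<in> vfields M.
        D (\<lambda>p f. X p f + Y p f) Z = (\<lambda>p f. D X Z p f + D Y Z p f) \<and>
        D X (\<lambda>p f. Y p f + Z p f) = (\<lambda>p f. D X Y p f + D X Z p f)) \<and>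
     (\<forall>X \<in> vfields M. \<forall>Y \<in> vfields M. \<forall>h. smooth_fun_on M (points M) h \<longrightarrow>
        D (\<lambda>p f. h p * X p f) Y = (\<lambda>p f. h p * D X Y p f) \<and>
        D X (\<lambda>p f. h p * Y p f) = (\<lambda>p f. X p h * Y p f + h p * D X Y p f))"

definition levi_civita ::
    "('a, 'e::euclidean_space) manifold \<Rightarrow> ('a \<Rightarrow> 'a tvec \<Rightarrow> 'a tvec \<Rightarrow> real) \<Rightarrow>
     ('a vfield \<Rightarrow> 'a vfield \<Rightarrow> 'a vfield) \<Rightarrow> bool" where
  "levi_civita M g D \<longleftrightarrow> affine_connection M D \<and>
     (\<forall>X \<in> vfields M. \<forall>Y \<in> vfields M.
        (\<lambda>p f. D X Y p f - D Y X p f) = lie_bracket M X Y) \<and>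
     (\<forall>X \<in> vfields M. \<forall>Y \<in> vfields M. \<forall>Z \<in> vfields M. \<forall>p \<in> points M.
        X p (\<lambda>q. g q (Y q) (Z q)) = g p (D X Y p) (Z p) + g p (Y p) (D X Z p))"


section \<open>Almost contact B-metric manifolds\<close>

definition almost_contact_B_metric ::
    "('a, 'e::euclidean_space) manifold \<Rightarrow> ('a \<Rightarrow> 'a tvec \<Rightarrow> 'a tvec) \<Rightarrow> 'a vfield \<Rightarrow>
     ('a \<Rightarrow> 'a tvec \<Rightarrow> real) \<Rightarrow> ('a \<Rightarrow> 'a tvec \<Rightarrow> 'a tvec \<Rightarrow> real) \<Rightarrow> bool" where
  "almost_contact_B_metric M \<phi> \<xi> \<eta> g \<longleftrightarrow>
     smooth_manifold M \<and> (\<exists>n. DIM('e) = 2 * n + 1) \<and>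
     tensor11 M \<phi> \<and> \<xi> \<in> vfields M \<and> one_form M \<eta> \<and> pseudo_riemannian M g \<and>
     (\<forall>p \<in> points M. \<phi> p (\<xi> p) = (\<lambda>f. 0) \<and> \<eta> p (\<xi> p) = 1 \<and>
        (\<forall>v \<in> tangent_space M p.
           \<phi> p (\<phi> p v) = (\<lambda>f. - v f + \<eta> p v * \<xi> p f) \<and> \<eta> p (\<phi> p v) = 0) \<and>
        (\<forall>v \<in> tangent_space M p. \<forall>w \<in> tangent_space M p.
           g p (\<phi> p v) (\<phi> p w) = - g p v w + \<eta> p v * \<eta> p w))"

text \<open>The tensor $F(X,Y,Z)=g((\nabla_X\varphi)Y,Z)$, with
  $(\nabla_X\varphi)Y=\nabla_X(\varphi Y)-\varphi(\nabla_X Y)$.\<close>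

definition F_tensor ::
    "('a, 'e) manifold \<Rightarrow> ('a \<Rightarrow> 'a tvec \<Rightarrow> 'a tvec) \<Rightarrow> ('a \<Rightarrow> 'a tvec \<Rightarrow> 'a tvec \<Rightarrow> real) \<Rightarrow>
     ('a vfield \<Rightarrow> 'a vfield \<Rightarrow> 'a vfield) \<Rightarrow> 'a vfield \<Rightarrow> 'a vfield \<Rightarrow> 'a vfield \<Rightarrow> 'a \<Rightarrow> real" where
  "F_tensor M \<phi> g D X Y Z p =
     g p (\<lambda>f. D X (app11 M \<phi> Y) p f - \<phi> p (D X Y p) f) (Z p)"

definition phi_basis ::
    "('a, 'e::euclidean_space) manifold \<Rightarrow> ('a \<Rightarrow> 'a tvec \<Rightarrow> 'a tvec) \<Rightarrow> 'a vfield \<Rightarrow>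
     ('a \<Rightarrow> 'a tvec \<Rightarrow> 'a tvec \<Rightarrow> real) \<Rightarrow> 'a \<Rightarrow> (nat \<Rightarrow> 'a tvec) \<Rightarrow> bool" where
  "phi_basis M \<phi> \<xi> g p u \<longleftrightarrow> tbasis M p u \<and> u 0 = \<xi> p \<and>
     \<phi> p (u 1) = u 2 \<and> \<phi> p (u 2) = (\<lambda>f. - u 1 f) \<and>
     g p (u 0) (u 0) = 1 \<and> g p (u 1) (u 1) = 1 \<and> g p (u 2) (u 2) = -1 \<and>
     (\<forall>i<3. \<forall>j<3. i \<noteq> j \<longrightarrow> g p (u i) (u j) = 0)"

definition F1_part :: "real \<Rightarrow> real \<Rightarrow> (nat \<Rightarrow> real) \<Rightarrow> (nat \<Rightarrow> real) \<Rightarrow> (nat \<Rightarrow> real) \<Rightarrow> real" where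
  "F1_part \<theta>1 \<theta>2 x y z = (x 1 * \<theta>1 - x 2 * \<theta>2) * (y 1 * z 1 + y 2 * z 2)"

definition F11_part :: "real \<Rightarrow> real \<Rightarrow> (nat \<Rightarrow> real) \<Rightarrow> (nat \<Rightarrow> real) \<Rightarrow> (nat \<Rightarrow> real) \<Rightarrow> real" where
  "F11_part \<omega>1 \<omega>2 x y z =
     x 0 * ((y 1 * z 0 + y 0 * z 1) * \<omega>1 + (y 2 * z 0 + y 0 * z 2) * \<omega>2)"

text \<open>The defining identity is required at every point \<open>p\<close> and for every basis of the tangent
  space at \<open>p\<close> of the prescribed kind. Tangent vectors at \<open>p\<close> are represented by
  vector fields taking these values at \<open>p\<close>; the value of \<open>F\<close> at \<open>p\<close> depends only on them.
  The quantified \<open>D\<close> is the Levi-Civita connection, which exists and is unique.\<close>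

definition class_F1_F11 ::
    "('a, 'e::euclidean_space) manifold \<Rightarrow> ('a \<Rightarrow> 'a tvec \<Rightarrow> 'a tvec) \<Rightarrow> 'a vfield \<Rightarrow>
     ('a \<Rightarrow> 'a tvec \<Rightarrow> real) \<Rightarrow> ('a \<Rightarrow> 'a tvec \<Rightarrow> 'a tvec \<Rightarrow> real) \<Rightarrow> bool" where
  "class_F1_F11 M \<phi> \<xi> \<eta> g \<longleftrightarrow> DIM('e) = 3 \<and> almost_contact_B_metric M \<phi> \<xi> \<eta> g \<and>
     (\<forall>D. levi_civita M g D \<longrightarrow>
       (\<forall>p \<in> points M. \<forall>E. (\<forall>i<3. E i \<in> vfields M) \<and> phi_basis M \<phi> \<xi> g p (\<lambda>i. E i p) \<longrightarrow>
         (\<exists>\<theta>1 \<theta>2 \<omega>1 \<omega>2.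
            (let Fc = (\<lambda>i j k. F_tensor M \<phi> g D (E i) (E j) (E k) p) in
             \<theta>1 = Fc 1 1 1 \<and> \<theta>1 = Fc 1 2 2 \<and>
             \<theta>2 = - Fc 2 1 1 \<and> \<theta>2 = - Fc 2 2 2 \<and>
             \<omega>1 = Fc 0 1 0 \<and> \<omega>1 = Fc 0 0 1 \<and>
             \<omega>2 = Fc 0 2 0 \<and> \<omega>2 = Fc 0 0 2) \<and>
            (\<forall>X \<in> vfields M. \<forall>Y \<in> vfields M. \<forall>Z \<in> vfields M. \<forall>x y z.
               X p = (\<lambda>f. \<Sum>i<3. x i * E i p f) \<and>
               Y p = (\<lambda>f. \<Sum>i<3. y i * E i p f) \<and>
               Z p = (\<lambda>f. \<Sum>i<3. z i * E i p f) \<longrightarrow>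
               F_tensor M \<phi> g D X Y Z p = F1_part \<theta>1 \<theta>2 x y z + F11_part \<omega>1 \<omega>2 x y z))))"


section \<open>Lie groups and left-invariant objects\<close>

definition lie_group :: "('a, 'b) monoid_scheme \<Rightarrow> ('a, 'e::euclidean_space) manifold \<Rightarrow> bool" where
  "lie_group G M \<longleftrightarrow> group G \<and> smooth_manifold M \<and> points M = carrier G \<and>
     smooth_map (prod_manifold M M) M (\<lambda>(x, y). x \<otimes>\<^bsub>G\<^esub> y) \<and>
     smooth_map M M (\<lambda>x. inv\<^bsub>G\<^esub> x)"

text \<open>The differential at \<open>p\<close> of the left translation by \<open>a\<close>.\<close>

definition dL :: "('a, 'b) monoid_scheme \<Rightarrow> ('a, 'e::euclidean_space) manifold \<Rightarrow>
    'a \<Rightarrow> 'a \<Rightarrow> 'a tvec \<Rightarrow> 'a tvec" where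
  "dL G M a p v = (\<lambda>f. if smooth_near M (a \<otimes>\<^bsub>G\<^esub> p) f then v (\<lambda>q. f (a \<otimes>\<^bsub>G\<^esub> q)) else 0)"

definition left_invariant_vfields ::
    "('a, 'b) monoid_scheme \<Rightarrow> ('a, 'e::euclidean_space) manifold \<Rightarrow> 'a vfield set" where
  "left_invariant_vfields G M = {X \<in> vfields M.
     \<forall>a \<in> carrier G. \<forall>p \<in> carrier G. X (a \<otimes>\<^bsub>G\<^esub> p) = dL G M a p (X p)}"

definition left_invariant11 :: "('a, 'b) monoid_scheme \<Rightarrow> ('a, 'e::euclidean_space) manifold \<Rightarrow>
    ('a \<Rightarrow> 'a tvec \<Rightarrow> 'a tvec) \<Rightarrow> bool" where
  "left_invariant11 G M \<phi> \<longleftrightarrow>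
     (\<forall>a \<in> carrier G. \<forall>p \<in> carrier G. \<forall>v \<in> tangent_space M p.
        \<phi> (a \<otimes>\<^bsub>G\<^esub> p) (dL G M a p v) = dL G M a p (\<phi> p v))"

definition left_invariant01 :: "('a, 'b) monoid_scheme \<Rightarrow> ('a, 'e::euclidean_space) manifold \<Rightarrow>
    ('a \<Rightarrow> 'a tvec \<Rightarrow> real) \<Rightarrow> bool" where
  "left_invariant01 G M \<eta> \<longleftrightarrow>
     (\<forall>a \<in> carrier G. \<forall>p \<in> carrier G. \<forall>v \<in> tangent_space M p.
        \<eta> (a \<otimes>\<^bsub>G\<^esub> p) (dL G M a p v) = \<eta> p v)"

definition left_invariant02 :: "('a, 'b) monoid_scheme \<Rightarrow> ('a, 'e::euclidean_space) manifold \<Rightarrow>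
    ('a \<Rightarrow> 'a tvec \<Rightarrow> 'a tvec \<Rightarrow> real) \<Rightarrow> bool" where
  "left_invariant02 G M g \<longleftrightarrow>
     (\<forall>a \<in> carrier G. \<forall>p \<in> carrier G. \<forall>v \<in> tangent_space M p. \<forall>w \<in> tangent_space M p.
        g (a \<otimes>\<^bsub>G\<^esub> p) (dL G M a p v) (dL G M a p w) = g p v w)"

text \<open>\<open>e 0, e 1, e 2\<close> form a basis of the Lie algebra of left-invariant vector fields,
  as a real vector space.\<close>

definition lie_algebra_basis ::
    "('a, 'b) monoid_scheme \<Rightarrow> ('a, 'e::euclidean_space) manifold \<Rightarrow> (nat \<Rightarrow> 'a vfield) \<Rightarrow> bool" where
  "lie_algebra_basis G M e \<longleftrightarrow> (\<forall>i<3. e i \<in> left_invariant_vfields G M) \<and>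
     (\<forall>X \<in> left_invariant_vfields G M. \<exists>x. X = (\<lambda>p f. \<Sum>i<3. x i * e i p f)) \<and>
     (\<forall>x. (\<forall>p f. (\<Sum>i<3. x i * e i p f) = 0) \<longrightarrow> (\<forall>i<3. x i = (0::real)))"

end

theory Submission
  imports Defs
begin

text \<open>The vector fields \<open>e 0, e 1, e 2\<close> form a global frame in which $g$, $\varphi$, $\eta$ and the
  brackets all have constant coefficients, so membership in the class comes down to a
  computation with finitely many real numbers.

  The frame is a basis of every tangent space: its Gram matrix
  is $\mathrm{diag}(1,1,-1)$, so its values are independent, and a chart identifies the tangent
  space with a Euclidean space of dimension 3 (\<open>tangent_space_basis\<close>, \<open>tangent_eq_comb\<close>). The
  coefficients of a vector field in the frame are its products with the frame fields up to sign,
  hence smooth. Since $F$ is linear over the smooth functions in each argument, it is therefore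
  determined at each point by its 27 components on the frame (\<open>F_tensor_frame\<close>).

  Because the products $g(e_i,e_j)$ are constant, the Koszul formula expresses $g(\nabla_{e_i}e_j,e_k)$
  through the structure constants alone (\<open>koszul_frame\<close>). This gives exactly
  $F=F^1+F^{11}$ with $\theta_1=2a$, $\theta_2=2b$, $\omega_1=c$ and $\omega_2=d$
  (\<open>F_tensor_class\<close>).

  The class asks for this shape in every admissible basis of every tangent space. There are only
  two such bases at a point, $(e_0,se_1,se_2)$ with $s=\pm1$ (\<open>phi_basis_unique\<close>), and passing from
  one to the other multiplies all four numbers by $s$.\<close>


section \<open>Calculus of $C^k$ functions on open sets\<close>

text \<open>Openness matters: for $k>0$ the predicate speaks of derivatives in the whole space, which see a
  neighbourhood of each point.\<close>

lemma Ck_on_cong: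
  assumes "open S" "\<And>x. x \<in> S \<Longrightarrow> f x = h x" "Ck_on k S f"
  shows "Ck_on k S h"
  using assms
proof (induction k arbitrary: f h)
  case 0
  then show ?case using continuous_on_cong by force
next
  case (Suc k)
  have d: "f differentiable (at x)" if "x \<in> S" for x
    using Suc.prems that by simp
  have "h differentiable (at x)" if "x \<in> S" for x
    using d[OF that] Suc.prems(1,2) that has_derivative_transform_within_open
    unfolding differentiable_def by meson
  moreover have "frechet_derivative f (at x) = frechet_derivative h (at x)" if "x \<in> S" for x
    using frechet_derivative_transform_within_open[OF d[OF that] Suc.prems(1) that] Suc.prems(2)
    by blast
  moreover have "Ck_on k S (\<lambda>x. frechet_derivative h (at x) w)" for w
    using Suc.IH[OF Suc.prems(1), of "\<lambda>x. frechet_derivative f (at x) w"] Suc.prems(3) calculation(2)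
    by simp
  ultimately show ?case by simp
qed

lemma Ck_on_subset: "Ck_on k S f \<Longrightarrow> T \<subseteq> S \<Longrightarrow> Ck_on k T f"
  by (induction k arbitrary: f) (auto intro: continuous_on_subset)

lemma Ck_on_Suc_imp: "Ck_on (Suc k) S f \<Longrightarrow> Ck_on k S f"
proof (induction k arbitrary: f)
  case 0
  then show ?case
    by (auto intro!: continuous_at_imp_continuous_on differentiable_imp_continuous_within)
next
  case (Suc k)
  then show ?case by (metis Ck_on.simps(2))
qed

lemma Ck_on_Suc_has_derivative:
  assumes "Ck_on (Suc k) S f" "x \<in> S"
  shows "(f has_derivative frechet_derivative f (at x)) (at x)"
  using assms by (simp add: frechet_derivative_works)

lemma Ck_on_const: "Ck_on k S (\<lambda>x. C)"
  by (induction k arbitrary: C) (auto simp: frechet_derivative_const)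

lemma Ck_on_add:
  assumes "open S" "Ck_on k S f" "Ck_on k S h"
  shows "Ck_on k S (\<lambda>x. f x + h x)"
  using assms(2,3)
proof (induction k arbitrary: f h)
  case 0
  then show ?case by (auto intro: continuous_on_add)
next
  case (Suc k)
  have d: "((\<lambda>x. f x + h x) has_derivative
      (\<lambda>w. frechet_derivative f (at x) w + frechet_derivative h (at x) w)) (at x)"
    if "x \<in> S" for x
    by (rule has_derivative_add[OF Suc.prems[THEN Ck_on_Suc_has_derivative, OF that]])
  have "Ck_on k S (\<lambda>x. frechet_derivative (\<lambda>x. f x + h x) (at x) w)" for w
  proof (rule Ck_on_cong[OF assms(1)])
    show "Ck_on k S (\<lambda>x. frechet_derivative f (at x) w + frechet_derivative h (at x) w)"
      using Suc by auto
  qed (rule fun_cong[OF frechet_derivative_at[OF d]])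
  then show ?case using Suc.prems by auto
qed

lemma Ck_on_mult:
  fixes f h :: "'e::euclidean_space \<Rightarrow> real"
  assumes "open S" "Ck_on k S f" "Ck_on k S h"
  shows "Ck_on k S (\<lambda>x. f x * h x)"
  using assms(2,3)
proof (induction k arbitrary: f h)
  case 0
  then show ?case by (auto intro: continuous_on_mult)
next
  case (Suc k)
  note low = Ck_on_Suc_imp[OF Suc.prems(1)] Ck_on_Suc_imp[OF Suc.prems(2)]
  have d: "((\<lambda>x. f x * h x) has_derivative
      (\<lambda>w. f x * frechet_derivative h (at x) w + frechet_derivative f (at x) w * h x)) (at x)"
    if "x \<in> S" for x
    by (rule has_derivative_mult[OF Suc.prems[THEN Ck_on_Suc_has_derivative, OF that]])
  have "Ck_on k S (\<lambda>x. frechet_derivative (\<lambda>x. f x * h x) (at x) w)" for w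
  proof (rule Ck_on_cong[OF assms(1)])
    show "Ck_on k S (\<lambda>x. f x * frechet_derivative h (at x) w + frechet_derivative f (at x) w * h x)"
      using Suc low by (intro Ck_on_add[OF assms(1)] Suc.IH) auto
  qed (rule fun_cong[OF frechet_derivative_at[OF d]])
  moreover have "(\<lambda>x. f x * h x) differentiable (at x)" if "x \<in> S" for x
    using d[OF that] by (rule differentiableI)
  ultimately show ?case by simp
qed


section \<open>Charts and smooth functions\<close>

text \<open>A coordinate map is a homeomorphism onto an open set, so the coordinate image of every open set is
  open; this is what makes the calculus above applicable to smooth functions on the manifold.\<close>

lemma chart_facts:
  assumes "smooth_manifold M" "(U, c) \<in> charts M"
  shows "openin (mtop M) U" "inj_on c U" "open (c ` U)"
    and "openin (mtop M) W \<Longrightarrow> open (c ` (U \<inter> W))"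
proof -
  show U: "openin (mtop M) U" and o: "open (c ` U)"
    using assms unfolding smooth_manifold_def by blast+
  have h: "homeomorphic_map (subtopology (mtop M) U) (top_of_set (c ` U)) c"
    using assms unfolding smooth_manifold_def by blast
  show "inj_on c U"
    using homeomorphic_imp_injective_map[OF h] openin_subset[OF U]
    by (simp add: inf.absorb2)
  show "open (c ` (U \<inter> W))" if "openin (mtop M) W"
  proof -
    have "openin (subtopology (mtop M) U) (U \<inter> W)"
      using that by (simp add: openin_subtopology_Int2)
    then have "openin (top_of_set (c ` U)) (c ` (U \<inter> W))"
      using homeomorphic_imp_open_map[OF h] by (simp add: open_map_def)
    then show ?thesis using o by (simp add: openin_open_eq)
  qed
qed

lemma smooth_fun_on_const: "smooth_fun_on M (points M) (\<lambda>p. C)"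
  by (auto simp: smooth_fun_on_def smooth_on_def comp_def Ck_on_const)

lemma smooth_fun_on_add:
  assumes "smooth_manifold M" "smooth_fun_on M W f" "smooth_fun_on M W h"
  shows "smooth_fun_on M W (\<lambda>p. f p + h p)"
  using assms(2,3) chart_facts(4)[OF assms(1)]
  by (auto simp: smooth_fun_on_def smooth_on_def comp_def intro!: Ck_on_add)

lemma smooth_fun_on_mult:
  assumes "smooth_manifold M" "smooth_fun_on M W f" "smooth_fun_on M W h"
  shows "smooth_fun_on M W (\<lambda>p. f p * h p)"
  using assms(2,3) chart_facts(4)[OF assms(1)]
  by (auto simp: smooth_fun_on_def smooth_on_def comp_def intro!: Ck_on_mult)

lemma smooth_fun_on_subset:
  assumes "smooth_fun_on M W f" "openin (mtop M) V" "V \<subseteq> W"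
  shows "smooth_fun_on M V f"
  using assms unfolding smooth_fun_on_def smooth_on_def
  by (fastforce intro: Ck_on_subset[where S="_ ` (_ \<inter> W)"])

lemma smooth_near_differentiable:
  assumes "smooth_near M p f" "(U, c) \<in> charts M" "p \<in> U"
  shows "(f \<circ> inv_into U c) differentiable (at (c p))"
proof -
  obtain W where "p \<in> W" "smooth_on (c ` (U \<inter> W)) (f \<circ> inv_into U c)"
    using assms unfolding smooth_near_def smooth_fun_on_def by blast
  then have "Ck_on (Suc 0) (c ` (U \<inter> W)) (f \<circ> inv_into U c)"
    unfolding smooth_on_def by blast
  then show ?thesis using \<open>p \<in> W\<close> assms(3) by simp
qed


section \<open>The tangent space\<close>

text \<open>The tangent vector with components \<open>w\<close> in the chart \<open>(U, c)\<close>.\<close>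

definition coord_tvec ::
    "('a, 'e::euclidean_space) manifold \<Rightarrow> 'a set \<Rightarrow> ('a \<Rightarrow> 'e) \<Rightarrow> 'a \<Rightarrow> 'e \<Rightarrow> 'a tvec" where
  "coord_tvec M U c p w = (\<lambda>f. if smooth_near M p f
     then frechet_derivative (f \<circ> inv_into U c) (at (c p)) w else 0)"

lemma linear_coord_tvec:
  assumes "(U, c) \<in> charts M" "p \<in> U"
  shows "linear (\<lambda>w. coord_tvec M U c p w f)"
  using linear_frechet_derivative[OF smooth_near_differentiable[OF _ assms]]
  by (cases "smooth_near M p f") (simp_all add: coord_tvec_def module_hom_zero)

text \<open>This is the chain rule for the transition map \<open>c \<circ> inv_into V d\<close>, whose derivative transforms the
  components.\<close>

lemma coord_tvec_change:
  assumes "smooth_manifold M" "(U, c) \<in> charts M" "p \<in> U" "(V, d) \<in> charts M" "p \<in> V"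
  shows "coord_tvec M V d p w =
    coord_tvec M U c p (frechet_derivative (c \<circ> inv_into V d) (at (d p)) w)"
proof
  fix f :: "'a \<Rightarrow> real"
  note U = chart_facts[OF assms(1,2)] and V = chart_facts[OF assms(1,4)]
  let ?t = "c \<circ> inv_into V d" and ?f = "f \<circ> inv_into U c"
  show "coord_tvec M V d p w f = coord_tvec M U c p (frechet_derivative ?t (at (d p)) w) f"
  proof (cases "smooth_near M p f")
    case True
    have "smooth_on (d ` (V \<inter> U)) ?t"
      using assms unfolding smooth_manifold_def by blast
    then have "Ck_on (Suc 0) (d ` (V \<inter> U)) ?t"
      unfolding smooth_on_def by blast
    then have t: "(?t has_derivative frechet_derivative ?t (at (d p))) (at (d p))"
      by (rule Ck_on_Suc_has_derivative) (use assms(3,5) in simp)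
    have tp: "?t (d p) = c p" using V(2) assms(5) by simp
    have "(?f has_derivative frechet_derivative ?f (at (c p))) (at (?t (d p)))"
      unfolding tp using smooth_near_differentiable[OF True assms(2,3)]
      by (simp add: frechet_derivative_works)
    from diff_chain_at[OF t this]
    have "((f \<circ> inv_into V d) has_derivative
        (frechet_derivative ?f (at (c p)) \<circ> frechet_derivative ?t (at (d p)))) (at (d p))"
    proof (rule has_derivative_transform_within_open)
      show "open (d ` (V \<inter> U))" using V(4) U(1) .
      show "(?f \<circ> ?t) x = (f \<circ> inv_into V d) x" if "x \<in> d ` (V \<inter> U)" for x
        using that U(2) V(2) by auto
    qed (use assms in auto)
    from fun_cong[OF frechet_derivative_at[OF this], of w] show ?thesis
      using True by (simp only: coord_tvec_def comp_apply if_True)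
  qed (simp add: coord_tvec_def)
qed

text \<open>By the transformation rule a single chart around the point already yields all tangent
  vectors. Hence the tangent space is the image of a linear map and inherits the vector space
  structure.\<close>

lemma tangent_space_chart:
  assumes "smooth_manifold M" "(U, c) \<in> charts M" "p \<in> U"
  shows "tangent_space M p = range (coord_tvec M U c p)"
proof -
  have "tangent_space M p = {v. \<exists>(V, d) \<in> charts M. p \<in> V \<and> (\<exists>w. v = coord_tvec M V d p w)}"
    unfolding tangent_space_def coord_tvec_def fun_eq_iff by simp
  moreover have "\<exists>w'. coord_tvec M V d p w = coord_tvec M U c p w'"
    if "(V, d) \<in> charts M" "p \<in> V" for V d w
    using coord_tvec_change[OF assms that] by blast
  ultimately show ?thesis using assms(2,3) by (auto simp: image_iff)
qed

lemma chart_exists: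
  assumes "smooth_manifold M" "p \<in> points M"
  obtains U c where "(U, c) \<in> charts M" "p \<in> U"
proof -
  have "p \<in> \<Union> (fst ` charts M)" using assms unfolding smooth_manifold_def by simp
  then show ?thesis using that by auto
qed

lemma tangent_space_lin:
  assumes "smooth_manifold M" "p \<in> points M" "v \<in> tangent_space M p" "w \<in> tangent_space M p"
  shows "(\<lambda>f. r * v f + s * w f) \<in> tangent_space M p"
proof -
  obtain U c where c: "(U, c) \<in> charts M" "p \<in> U" using chart_exists assms by metis
  obtain x y where "v = coord_tvec M U c p x" "w = coord_tvec M U c p y"
    using assms(3,4) tangent_space_chart[OF assms(1) c] by auto
  then have "(\<lambda>f. r * v f + s * w f) = coord_tvec M U c p (r *\<^sub>R x + s *\<^sub>R y)"
    by (simp add: fun_eq_iff linear_add[OF linear_coord_tvec[OF c]]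
        linear_scale[OF linear_coord_tvec[OF c]])
  then show ?thesis using tangent_space_chart[OF assms(1) c] by simp
qed

lemma tangent_space_zero:
  assumes "smooth_manifold M" "p \<in> points M"
  shows "(\<lambda>f. 0) \<in> tangent_space M p"
proof -
  obtain U c where c: "(U, c) \<in> charts M" "p \<in> U" using chart_exists assms by metis
  have "(\<lambda>f. 0) = coord_tvec M U c p 0"
    by (simp add: fun_eq_iff linear_0[OF linear_coord_tvec[OF c]])
  then show ?thesis using tangent_space_chart[OF assms(1) c] by simp
qed

lemma tangent_space_sum:
  assumes "smooth_manifold M" "p \<in> points M" "\<And>i. i < (n::nat) \<Longrightarrow> u i \<in> tangent_space M p"
  shows "(\<lambda>f. \<Sum>i<n. x i * u i f) \<in> tangent_space M p"
  using assms(3)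
proof (induction n)
  case 0
  then show ?case using tangent_space_zero assms by simp
next
  case (Suc n)
  then show ?case
    using tangent_space_lin[OF assms(1,2), of "\<lambda>f. \<Sum>i<n. x i * u i f" "u n" 1 "x n"] by simp
qed

lemma tangent_linear_sum:
  fixes L :: "'a tvec \<Rightarrow> real"
  assumes "smooth_manifold M" "p \<in> points M"
    and L: "\<And>v w r s. v \<in> tangent_space M p \<Longrightarrow> w \<in> tangent_space M p \<Longrightarrow>
       L (\<lambda>f. r * v f + s * w f) = r * L v + s * L w"
    and "\<And>i. i < (n::nat) \<Longrightarrow> u i \<in> tangent_space M p"
  shows "L (\<lambda>f. \<Sum>i<n. x i * u i f) = (\<Sum>i<n. x i * L (u i))"
  using assms(4)
proof (induction n)
  case 0
  show ?case using L[OF tangent_space_zero[OF assms(1,2)] tangent_space_zero[OF assms(1,2)], of 0 0]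
    by simp
next
  case (Suc n)
  then show ?case
    using L[OF tangent_space_sum[OF assms(1,2), of n u x], of "u n" 1 "x n"] by simp
qed

text \<open>A chart domain consists of points of the manifold, so the coordinate expression of \<open>f\<close> is constant
  near the point whatever \<open>f\<close> does elsewhere in the type. This applies to functions such as
  $g(e_i,e_j)$, which are known only at the points.\<close>

lemma tangent_vector_local:
  assumes "smooth_manifold M" "p \<in> points M" "v \<in> tangent_space M p"
    and "\<And>q. q \<in> points M \<Longrightarrow> f q = C"
  shows "v f = 0"
proof -
  obtain U c where c: "(U, c) \<in> charts M" "p \<in> U" using chart_exists assms by metis
  note U = chart_facts[OF assms(1) c(1)]
  obtain w where w: "v = coord_tvec M U c p w"
    using assms(3) tangent_space_chart[OF assms(1) c] by auto
  have "((f \<circ> inv_into U c) has_derivative (\<lambda>_. 0)) (at (c p))"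
  proof (rule has_derivative_transform_within_open)
    show "((\<lambda>x. C) has_derivative (\<lambda>_. 0)) (at (c p))" by simp
    show "C = (f \<circ> inv_into U c) x" if "x \<in> c ` U" for x
      using that U(2) openin_subset[OF U(1)] assms(4) by auto
  qed (use U c in auto)
  from fun_cong[OF frechet_derivative_at[OF this], of w] show ?thesis
    unfolding w coord_tvec_def by simp
qed

lemma independent_family_spans:
  fixes w :: "nat \<Rightarrow> 'e::euclidean_space"
  assumes ind: "\<And>x. (\<Sum>i<DIM('e). x i *\<^sub>R w i) = 0 \<Longrightarrow> \<forall>i<DIM('e). x i = 0"
  shows "\<exists>x. v = (\<Sum>i<DIM('e). x i *\<^sub>R w i)"
proof -
  let ?I = "{..<DIM('e)}"
  have inj: "inj_on w ?I"
  proof (rule inj_onI, rule ccontr)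
    fix i j assume ij: "i \<in> ?I" "j \<in> ?I" "w i = w j" "i \<noteq> j"
    \<comment> \<open>A repeated vector gives the nontrivial relation \<open>w i - w j = 0\<close>.\<close>
    let ?x = "\<lambda>k. (if k = i then 1 else 0) - (if k = j then 1 else (0::real))"
    have "(\<Sum>k\<in>?I. ?x k *\<^sub>R w k) = 0"
      using ij by (simp add: scaleR_diff_left sum_subtractf if_distrib[of "\<lambda>r. r *\<^sub>R _"] cong: if_cong)
    from ind[OF this] ij show False by auto
  qed
  have "independent (w ` ?I)"
  proof (rule independent_if_scalars_zero)
    fix x b assume z: "(\<Sum>b\<in>w ` ?I. x b *\<^sub>R b) = 0" and b: "b \<in> w ` ?I"
    from z have "(\<Sum>i\<in>?I. x (w i) *\<^sub>R w i) = 0" using inj by (simp add: sum.reindex)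
    from ind[OF this] b show "x b = 0" by auto
  qed simp
  moreover have "card (w ` ?I) = DIM('e)" using inj by (simp add: card_image)
  ultimately have "v \<in> span (w ` ?I)"
    using card_ge_dim_independent[of "w ` ?I" UNIV] by auto
  then obtain x where "v = (\<Sum>b\<in>w ` ?I. x b *\<^sub>R b)"
    by (auto simp: span_finite)
  then have "v = (\<Sum>i\<in>?I. x (w i) *\<^sub>R w i)" using inj by (simp add: sum.reindex)
  then show ?thesis by (intro exI)
qed

text \<open>Components in a chart turn independence of the tangent vectors into independence of as many elements
  of \<open>'e\<close> as its dimension, and those span \<open>'e\<close>.\<close>

lemma tangent_space_basis:
  fixes M :: "('a, 'e::euclidean_space) manifold"
  assumes "smooth_manifold M" "p \<in> points M"
    and "\<And>i. i < DIM('e) \<Longrightarrow> u i \<in> tangent_space M p"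
    and ind: "\<And>x. (\<lambda>f. \<Sum>i<DIM('e). x i * u i f) = (\<lambda>f. 0) \<Longrightarrow> \<forall>i<DIM('e). x i = 0"
    and "v \<in> tangent_space M p"
  shows "\<exists>x. v = (\<lambda>f. \<Sum>i<DIM('e). x i * u i f)"
proof -
  obtain U c where c: "(U, c) \<in> charts M" "p \<in> U" using chart_exists assms by metis
  note T = tangent_space_chart[OF assms(1) c]
  have "\<forall>i. \<exists>w. i < DIM('e) \<longrightarrow> u i = coord_tvec M U c p w" using assms(3) T by blast
  then obtain w where w: "\<And>i. i < DIM('e) \<Longrightarrow> u i = coord_tvec M U c p (w i)" by metis
  have comb: "(\<lambda>f. \<Sum>i<DIM('e). x i * u i f) = coord_tvec M U c p (\<Sum>i<DIM('e). x i *\<^sub>R w i)" for x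
    by (simp add: fun_eq_iff linear_sum[OF linear_coord_tvec[OF c]]
        linear_scale[OF linear_coord_tvec[OF c]] w)
  obtain z where z: "v = coord_tvec M U c p z" using assms(5) T by blast
  have "\<exists>x. z = (\<Sum>i<DIM('e). x i *\<^sub>R w i)"
  proof (rule independent_family_spans, rule ind)
    fix x assume "(\<Sum>i<DIM('e). x i *\<^sub>R w i) = 0"
    then show "(\<lambda>f. \<Sum>i<DIM('e). x i * u i f) = (\<lambda>f. 0)"
      unfolding comb by (simp add: fun_eq_iff linear_0[OF linear_coord_tvec[OF c]])
  qed
  then show ?thesis using z comb by metis
qed


section \<open>Vector fields as a module over the smooth functions\<close>

lemma vfields_scale:
  assumes "smooth_manifold M" "X \<in> vfields M" "smooth_fun_on M (points M) h"
  shows "(\<lambda>p f. h p * X p f) \<in> vfields M"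
proof -
  have "(\<lambda>f. h p * X p f) \<in> tangent_space M p" if "p \<in> points M" for p
    using tangent_space_lin[OF assms(1) that, of "X p" "X p" "h p" 0] assms(2) that
    by (simp add: vfields_def)
  moreover have "smooth_fun_on M W (\<lambda>p. h p * X p f)" if "smooth_fun_on M W f" for W f
  proof (rule smooth_fun_on_mult[OF assms(1)])
    show "smooth_fun_on M W h"
      using smooth_fun_on_subset[OF assms(3)] that openin_subset
      by (metis smooth_fun_on_def)
  qed (use assms(2) that in \<open>auto simp: vfields_def\<close>)
  ultimately show ?thesis using assms(2) by (auto simp: vfields_def)
qed

lemma vfields_add:
  assumes "smooth_manifold M" "X \<in> vfields M" "Y \<in> vfields M"
  shows "(\<lambda>p f. X p f + Y p f) \<in> vfields M"
  using assms tangent_space_lin[OF assms(1), of _ "X _" "Y _" 1 1] smooth_fun_on_add[OF assms(1)]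
  by (auto simp: vfields_def)

lemma vfields_zero:
  assumes "smooth_manifold M"
  shows "(\<lambda>p f. 0) \<in> vfields M"
proof -
  have "smooth_fun_on M W (\<lambda>p. 0)" if "smooth_fun_on M W f" for W f
    using smooth_fun_on_subset[OF smooth_fun_on_const[of M 0]] that openin_subset
    unfolding smooth_fun_on_def by blast
  then show ?thesis using tangent_space_zero[OF assms] by (simp add: vfields_def)
qed

lemma vfields_lincomb:
  assumes "smooth_manifold M"
    and "\<And>i. i < (n::nat) \<Longrightarrow> X i \<in> vfields M \<and> smooth_fun_on M (points M) (h i)"
  shows "(\<lambda>p f. \<Sum>i<n. h i p * X i p f) \<in> vfields M"
  using assms(2)
proof (induction n)
  case 0
  show ?case using vfields_zero[OF assms(1)] by simp
next
  case (Suc n)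
  then show ?case
    using vfields_add[OF assms(1) _ vfields_scale[OF assms(1), of "X n" "h n"],
      of "\<lambda>p f. \<Sum>i<n. h i p * X i p f"] by simp
qed


section \<open>Connections on combinations of vector fields\<close>

lemma connection_add:
  assumes "affine_connection M D" "X \<in> vfields M" "Y \<in> vfields M" "Z \<in> vfields M"
  shows "D (\<lambda>p f. X p f + Y p f) Z = (\<lambda>p f. D X Z p f + D Y Z p f)"
    and "D Z (\<lambda>p f. X p f + Y p f) = (\<lambda>p f. D Z X p f + D Z Y p f)"
  using assms unfolding affine_connection_def by blast+

lemma connection_scale:
  assumes "affine_connection M D" "X \<in> vfields M" "Y \<in> vfields M" "smooth_fun_on M (points M) h"
  shows "D (\<lambda>p f. h p * X p f) Y = (\<lambda>p f. h p * D X Y p f)"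
    and "D X (\<lambda>p f. h p * Y p f) = (\<lambda>p f. X p h * Y p f + h p * D X Y p f)"
  using assms unfolding affine_connection_def by blast+

lemma connection_vfields:
  assumes "affine_connection M D" "X \<in> vfields M" "Y \<in> vfields M"
  shows "D X Y \<in> vfields M"
  using assms unfolding affine_connection_def by blast

lemma connection_lincomb_left:
  assumes M: "smooth_manifold M" and D: "affine_connection M D" and Y: "Y \<in> vfields M"
    and "\<And>i. i < (n::nat) \<Longrightarrow> X i \<in> vfields M \<and> smooth_fun_on M (points M) (h i)"
  shows "D (\<lambda>p f. \<Sum>i<n. h i p * X i p f) Y = (\<lambda>p f. \<Sum>i<n. h i p * D (X i) Y p f)"
  using assms(4)
proof (induction n)
  case 0
  from connection_scale(1)[OF D Y Y smooth_fun_on_const[of M 0]]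
  show ?case by simp
next
  case (Suc n)
  let ?S = "\<lambda>p f. \<Sum>i<n. h i p * X i p f" and ?T = "\<lambda>p f. h n p * X n p f"
  have "?S \<in> vfields M" "?T \<in> vfields M"
    using Suc.prems vfields_lincomb[OF M, of n X h] vfields_scale[OF M] by auto
  from connection_add(1)[OF D this Y] connection_scale(1)[OF D _ Y, of "X n" "h n"]
  show ?case using Suc by simp
qed

lemma connection_lincomb_right:
  assumes M: "smooth_manifold M" and D: "affine_connection M D" and X: "X \<in> vfields M"
    and "\<And>i. i < (n::nat) \<Longrightarrow> Y i \<in> vfields M \<and> smooth_fun_on M (points M) (h i)"
  shows "D X (\<lambda>p f. \<Sum>i<n. h i p * Y i p f) =
    (\<lambda>p f. \<Sum>i<n. X p (h i) * Y i p f + h i p * D X (Y i) p f)"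
  using assms(4)
proof (induction n)
  case 0
  \<comment> \<open>The derivative of the zero field equals its own double.\<close>
  note Z = vfields_zero[OF M]
  from connection_add(2)[OF D Z Z X]
  have "D X (\<lambda>p f. 0) = (\<lambda>p f. D X (\<lambda>p f. 0) p f + D X (\<lambda>p f. 0) p f)" by simp
  then have "D X (\<lambda>p f. 0) = (\<lambda>p f. 0)" by (simp add: fun_eq_iff)
  then show ?case by simp
next
  case (Suc n)
  let ?S = "\<lambda>p f. \<Sum>i<n. h i p * Y i p f" and ?T = "\<lambda>p f. h n p * Y n p f"
  have "?S \<in> vfields M" "?T \<in> vfields M"
    using Suc.prems vfields_lincomb[OF M, of n Y h] vfields_scale[OF M] by auto
  from connection_add(2)[OF D this X] connection_scale(2)[OF D X, of "Y n" "h n"]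
  show ?case using Suc by (simp add: add.assoc)
qed


lemma levi_civita_rules:
  assumes "levi_civita M g D"
  shows "affine_connection M D"
    and "\<lbrakk>X \<in> vfields M; Y \<in> vfields M\<rbrakk> \<Longrightarrow>
      (\<lambda>p f. D X Y p f - D Y X p f) = lie_bracket M X Y"
    and "\<lbrakk>X \<in> vfields M; Y \<in> vfields M; Z \<in> vfields M; p \<in> points M\<rbrakk> \<Longrightarrow>
      X p (\<lambda>q. g q (Y q) (Z q)) = g p (D X Y p) (Z p) + g p (Y p) (D X Z p)"
  using assms unfolding levi_civita_def by simp_all


section \<open>Linearity of the tensor F over smooth functions\<close>

lemma vfields_tangent: "X \<in> vfields M \<Longrightarrow> p \<in> points M \<Longrightarrow> X p \<in> tangent_space M p"
  by (simp add: vfields_def)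

lemma vfields_outside: "X \<in> vfields M \<Longrightarrow> p \<notin> points M \<Longrightarrow> X p = (\<lambda>f. 0)"
  by (simp add: vfields_def)

lemma tensor11_rules:
  assumes "tensor11 M \<phi>"
  shows "\<lbrakk>p \<in> points M; v \<in> tangent_space M p\<rbrakk> \<Longrightarrow> \<phi> p v \<in> tangent_space M p"
    and "\<lbrakk>p \<in> points M; v \<in> tangent_space M p; w \<in> tangent_space M p\<rbrakk> \<Longrightarrow>
      \<phi> p (\<lambda>f. r * v f + s * w f) = (\<lambda>f. r * \<phi> p v f + s * \<phi> p w f)"
    and "X \<in> vfields M \<Longrightarrow> app11 M \<phi> X \<in> vfields M"
  using assms unfolding tensor11_def by blast+

lemma tensor11_sum:
  assumes "smooth_manifold M" "tensor11 M \<phi>" "p \<in> points M"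
    and "\<And>i. i < (n::nat) \<Longrightarrow> u i \<in> tangent_space M p"
  shows "\<phi> p (\<lambda>f. \<Sum>i<n. x i * u i f) = (\<lambda>f. \<Sum>i<n. x i * \<phi> p (u i) f)"
proof
  fix f
  show "\<phi> p (\<lambda>f. \<Sum>i<n. x i * u i f) f = (\<Sum>i<n. x i * \<phi> p (u i) f)"
    by (rule tangent_linear_sum[OF assms(1,3) _ assms(4)])
      (simp add: tensor11_rules(2)[OF assms(2,3)])
qed

lemma symmetric_tensor02_rules:
  assumes "symmetric_tensor02 M g"
  shows "\<lbrakk>p \<in> points M; u \<in> tangent_space M p; v \<in> tangent_space M p; w \<in> tangent_space M p\<rbrakk> \<Longrightarrow>
      g p (\<lambda>f. r * v f + s * w f) u = r * g p v u + s * g p w u"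
    and "\<lbrakk>X \<in> vfields M; Y \<in> vfields M\<rbrakk> \<Longrightarrow> smooth_fun_on M (points M) (\<lambda>p. g p (X p) (Y p))"
  using assms unfolding symmetric_tensor02_def by blast+

lemma metric_sum_left:
  assumes "smooth_manifold M" "symmetric_tensor02 M g" "p \<in> points M"
    and "\<And>i. i < (n::nat) \<Longrightarrow> u i \<in> tangent_space M p" "v \<in> tangent_space M p"
  shows "g p (\<lambda>f. \<Sum>i<n. x i * u i f) v = (\<Sum>i<n. x i * g p (u i) v)"
proof (rule tangent_linear_sum[OF assms(1,3) _ assms(4)])
  show "g p (\<lambda>f. r * v1 f + s * w f) v = r * g p v1 v + s * g p w v"
    if "v1 \<in> tangent_space M p" "w \<in> tangent_space M p" for v1 w r s
    using assms(2,3,5) that unfolding symmetric_tensor02_def by blast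
qed

lemma metric_sym:
  assumes "symmetric_tensor02 M g" "p \<in> points M" "u \<in> tangent_space M p" "v \<in> tangent_space M p"
  shows "g p u v = g p v u"
  using assms unfolding symmetric_tensor02_def by blast

lemma metric_sum_right:
  assumes "smooth_manifold M" "symmetric_tensor02 M g" "p \<in> points M"
    and "\<And>i. i < (n::nat) \<Longrightarrow> u i \<in> tangent_space M p" "v \<in> tangent_space M p"
  shows "g p v (\<lambda>f. \<Sum>i<n. x i * u i f) = (\<Sum>i<n. x i * g p v (u i))"
  using metric_sum_left[OF assms, where x=x] metric_sym[OF assms(2,3,5)] assms(4)
    tangent_space_sum[OF assms(1,3,4), where x=x] by simp

lemma nabla_phi_tangent:
  assumes "smooth_manifold M" "affine_connection M D" "tensor11 M \<phi>" "X \<in> vfields M" "Y \<in> vfields M"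
    and "p \<in> points M"
  shows "(\<lambda>f. D X (app11 M \<phi> Y) p f - \<phi> p (D X Y p) f) \<in> tangent_space M p"
proof -
  have "D X (app11 M \<phi> Y) p \<in> tangent_space M p" "\<phi> p (D X Y p) \<in> tangent_space M p"
    using vfields_tangent[OF connection_vfields[OF assms(2,4)] assms(6)] assms(5)
    by (simp_all add: tensor11_rules[OF assms(3)] assms(6))
  from tangent_space_lin[OF assms(1,6) this, of 1 "-1"] show ?thesis by simp
qed

lemma F_tensor_sum_left:
  assumes M: "smooth_manifold M" and D: "affine_connection M D" and \<phi>: "tensor11 M \<phi>"
    and g: "symmetric_tensor02 M g" and Y: "Y \<in> vfields M" and Z: "Z \<in> vfields M"
    and p: "p \<in> points M"
    and X: "\<And>i. i < (n::nat) \<Longrightarrow> X i \<in> vfields M \<and> smooth_fun_on M (points M) (h i)"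
  shows "F_tensor M \<phi> g D (\<lambda>p f. \<Sum>i<n. h i p * X i p f) Y Z p =
    (\<Sum>i<n. h i p * F_tensor M \<phi> g D (X i) Y Z p)"
proof -
  have \<phi>Y: "app11 M \<phi> Y \<in> vfields M" using tensor11_rules(3)[OF \<phi> Y] .
  have T: "D (X i) Y p \<in> tangent_space M p" if "i < n" for i
    using vfields_tangent[OF connection_vfields[OF D _ Y] p] X[OF that] by blast
  have "(\<lambda>f. D (\<lambda>p f. \<Sum>i<n. h i p * X i p f) (app11 M \<phi> Y) p f
        - \<phi> p (D (\<lambda>p f. \<Sum>i<n. h i p * X i p f) Y p) f)
     = (\<lambda>f. \<Sum>i<n. h i p * (D (X i) (app11 M \<phi> Y) p f - \<phi> p (D (X i) Y p) f))"
    by (simp add: connection_lincomb_left[OF M D Y X] connection_lincomb_left[OF M D \<phi>Y X]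
        tensor11_sum[OF M \<phi> p T] right_diff_distrib sum_subtractf)
  then show ?thesis
    unfolding F_tensor_def
    using metric_sum_left[OF M g p nabla_phi_tangent[OF M D \<phi> _ Y p] vfields_tangent[OF Z p],
        of n X "\<lambda>i. h i p"] X by simp
qed

lemma app11_lincomb:
  assumes "smooth_manifold M" "tensor11 M \<phi>" "\<And>i. i < (n::nat) \<Longrightarrow> Y i \<in> vfields M"
  shows "app11 M \<phi> (\<lambda>p f. \<Sum>i<n. h i p * Y i p f) = (\<lambda>p f. \<Sum>i<n. h i p * app11 M \<phi> (Y i) p f)"
  using tensor11_sum[OF assms(1,2) _ vfields_tangent[OF assms(3)]]
  by (auto simp: app11_def fun_eq_iff)

text \<open>The derivatives of the coefficients contribute $\sum_i X(h_i)\,\varphi Y_i$ both to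
  $\nabla_X(\varphi Y)$ and to $\varphi(\nabla_X Y)$, and cancel in $(\nabla_X\varphi)Y$.\<close>

lemma F_tensor_sum_middle:
  assumes M: "smooth_manifold M" and D: "affine_connection M D" and \<phi>: "tensor11 M \<phi>"
    and g: "symmetric_tensor02 M g" and X: "X \<in> vfields M" and Z: "Z \<in> vfields M"
    and p: "p \<in> points M"
    and Y: "\<And>i. i < (n::nat) \<Longrightarrow> Y i \<in> vfields M \<and> smooth_fun_on M (points M) (h i)"
  shows "F_tensor M \<phi> g D X (\<lambda>p f. \<Sum>i<n. h i p * Y i p f) Z p =
    (\<Sum>i<n. h i p * F_tensor M \<phi> g D X (Y i) Z p)"
proof -
  have \<phi>Y: "app11 M \<phi> (Y i) \<in> vfields M \<and> smooth_fun_on M (points M) (h i)" if "i < n" for i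
    using tensor11_rules(3)[OF \<phi>] Y[OF that] by blast
  have YT: "Y i p \<in> tangent_space M p" and DT: "D X (Y i) p \<in> tangent_space M p" if "i < n" for i
    using vfields_tangent[OF connection_vfields[OF D X] p] vfields_tangent[OF _ p] Y[OF that]
    by blast+
  have T: "(\<lambda>f. X p (h i) * Y i p f + h i p * D X (Y i) p f) \<in> tangent_space M p" if "i < n" for i
    using tangent_space_lin[OF M p YT[OF that] DT[OF that]] .
  have lin: "\<phi> p (\<lambda>f. r * v f + s * w f) = (\<lambda>f. r * \<phi> p v f + s * \<phi> p w f)"
    if "v \<in> tangent_space M p" "w \<in> tangent_space M p" for r s v w
    using tensor11_rules(2)[OF \<phi> p that] .
  have "(\<lambda>f. D X (app11 M \<phi> (\<lambda>p f. \<Sum>i<n. h i p * Y i p f)) p f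
        - \<phi> p (D X (\<lambda>p f. \<Sum>i<n. h i p * Y i p f) p) f)
     = (\<lambda>f. \<Sum>i<n. h i p * (D X (app11 M \<phi> (Y i)) p f - \<phi> p (D X (Y i) p) f))"
    (is "?l = ?r")
  proof
    fix f
    have "\<phi> p (D X (\<lambda>p f. \<Sum>i<n. h i p * Y i p f) p) f
        = (\<Sum>i<n. 1 * \<phi> p (\<lambda>f. X p (h i) * Y i p f + h i p * D X (Y i) p f) f)"
      using tensor11_sum[OF M \<phi> p T, where x="\<lambda>_. 1"]
      by (simp add: connection_lincomb_right[OF M D X Y])
    also have "\<dots> = (\<Sum>i<n. X p (h i) * \<phi> p (Y i p) f + h i p * \<phi> p (D X (Y i) p) f)"
      by (intro sum.cong refl) (simp add: lin YT DT)
    finally have r: "\<phi> p (D X (\<lambda>p f. \<Sum>i<n. h i p * Y i p f) p) f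
        = (\<Sum>i<n. X p (h i) * \<phi> p (Y i p) f + h i p * \<phi> p (D X (Y i) p) f)" .
    have "D X (app11 M \<phi> (\<lambda>p f. \<Sum>i<n. h i p * Y i p f)) p f
        = (\<Sum>i<n. X p (h i) * app11 M \<phi> (Y i) p f + h i p * D X (app11 M \<phi> (Y i)) p f)"
      using Y by (simp add: app11_lincomb[OF M \<phi>] connection_lincomb_right[OF M D X \<phi>Y])
    also have "\<dots> = (\<Sum>i<n. X p (h i) * \<phi> p (Y i p) f + h i p * D X (app11 M \<phi> (Y i)) p f)"
      using p by (simp add: app11_def[of M \<phi> "Y _"])
    finally show "?l f = ?r f"
      by (simp add: r sum_subtractf[symmetric] algebra_simps)
  qed
  then show ?thesis
    unfolding F_tensor_def
    using metric_sum_left[OF M g p nabla_phi_tangent[OF M D \<phi> X _ p] vfields_tangent[OF Z p],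
        of n Y "\<lambda>i. h i p"] Y by simp
qed

lemma F_tensor_sum_right:
  assumes M: "smooth_manifold M" and D: "affine_connection M D" and \<phi>: "tensor11 M \<phi>"
    and g: "symmetric_tensor02 M g" and X: "X \<in> vfields M" and Y: "Y \<in> vfields M"
    and p: "p \<in> points M" and Z: "\<And>i. i < (n::nat) \<Longrightarrow> Z i \<in> vfields M"
    and W: "W p = (\<lambda>f. \<Sum>i<n. z i * Z i p f)"
  shows "F_tensor M \<phi> g D X Y W p = (\<Sum>i<n. z i * F_tensor M \<phi> g D X Y (Z i) p)"
  unfolding F_tensor_def W
  using metric_sum_right[OF M g p vfields_tangent[OF Z p] nabla_phi_tangent[OF M D \<phi> X Y p]] .


section \<open>Frames adapted to the structure\<close>

lemma sum_lessThan_3: "(\<Sum>i<3. f i) = f 0 + f 1 + f (2::nat)"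
  by (simp add: numeral_3_eq_3 numeral_2_eq_2)

lemma less_3_cases: "i < (3::nat) \<Longrightarrow> i = 0 \<or> i = 1 \<or> i = 2"
  by auto

text \<open>The diagonal of the Gram matrix of the frame; its entries are their own inverses.\<close>

definition frame_sign :: "nat \<Rightarrow> real" where
  "frame_sign i = (if i = 2 then -1 else 1)"

text \<open>The matrix of $\varphi$ in the frame: zero on $e_0$, a quarter turn of the plane of $e_1,e_2$.\<close>

definition phi_coords :: "(nat \<Rightarrow> real) \<Rightarrow> nat \<Rightarrow> real" where
  "phi_coords x i = (if i = 1 then - x 2 else if i = 2 then x 1 else 0)"

locale adapted_frame =
  fixes M :: "('a, 'e::euclidean_space) manifold"
    and \<phi> :: "'a \<Rightarrow> 'a tvec \<Rightarrow> 'a tvec"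
    and g :: "'a \<Rightarrow> 'a tvec \<Rightarrow> 'a tvec \<Rightarrow> real"
    and e :: "nat \<Rightarrow> 'a vfield"
  assumes manifold: "smooth_manifold M"
    and dim: "DIM('e) = 3"
    and phi_tensor: "tensor11 M \<phi>"
    and metric: "symmetric_tensor02 M g"
    and frame: "i < 3 \<Longrightarrow> e i \<in> vfields M"
    and phi_frame: "p \<in> points M \<Longrightarrow>
      \<phi> p (e 0 p) = (\<lambda>f. 0) \<and> \<phi> p (e 1 p) = e 2 p \<and> \<phi> p (e 2 p) = (\<lambda>f. - e 1 p f)"
    and orthonormal: "p \<in> points M \<Longrightarrow> i < 3 \<Longrightarrow> j < 3 \<Longrightarrow>
      g p (e i p) (e j p) = (if i = j then frame_sign i else 0)"
begin

abbreviation comb :: "'a \<Rightarrow> (nat \<Rightarrow> real) \<Rightarrow> 'a tvec" where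
  "comb p x \<equiv> (\<lambda>f. \<Sum>i<3. x i * e i p f)"

lemma frame_tangent: "p \<in> points M \<Longrightarrow> i < 3 \<Longrightarrow> e i p \<in> tangent_space M p"
  by (rule vfields_tangent[OF frame])

lemma comb_tangent: "p \<in> points M \<Longrightarrow> comb p x \<in> tangent_space M p"
  by (rule tangent_space_sum[where u="\<lambda>i. e i p", OF manifold _ frame_tangent])

lemma metric_comb_frame:
  assumes "p \<in> points M" "j < 3"
  shows "g p (comb p x) (e j p) = frame_sign j * x j"
proof -
  have "g p (comb p x) (e j p) = (\<Sum>i<3. x i * g p (e i p) (e j p))"
    by (rule metric_sum_left[where u="\<lambda>i. e i p", OF manifold metric assms(1)
          frame_tangent[OF assms(1)] frame_tangent[OF assms]])
  also have "\<dots> = (\<Sum>i<3. if i = j then frame_sign j * x j else 0)"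
    by (intro sum.cong refl) (simp add: orthonormal assms)
  finally show ?thesis using assms(2) by simp
qed

lemma metric_comb:
  assumes "p \<in> points M"
  shows "g p (comb p x) (comb p y) = (\<Sum>i<3. frame_sign i * x i * y i)"
proof -
  have "g p (comb p x) (comb p y) = (\<Sum>i<3. y i * g p (comb p x) (e i p))"
    by (rule metric_sum_right[where u="\<lambda>i. e i p", OF manifold metric assms
          frame_tangent[OF assms] comb_tangent[OF assms]])
  then show ?thesis by (simp add: metric_comb_frame assms mult_ac)
qed

lemma phi_comb:
  assumes "p \<in> points M"
  shows "\<phi> p (comb p x) = comb p (phi_coords x)"
proof -
  have "\<phi> p (comb p x) = (\<lambda>f. \<Sum>i<3. x i * \<phi> p (e i p) f)"
    by (rule tensor11_sum[where u="\<lambda>i. e i p", OF manifold phi_tensor assms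
          frame_tangent[OF assms]])
  then show ?thesis using phi_frame[OF assms] by (simp add: sum_lessThan_3 phi_coords_def)
qed

lemma frame_sign_square: "frame_sign i * frame_sign i = 1"
  by (simp add: frame_sign_def)

text \<open>Pairing a relation between the frame vectors with each of them kills its coefficients, so they are a
  basis; pairing the resulting expansion of \<open>v\<close> with them recovers its coefficients.\<close>

lemma tangent_eq_comb:
  assumes "p \<in> points M" "v \<in> tangent_space M p"
  shows "v = comb p (\<lambda>i. frame_sign i * g p v (e i p))"
proof -
  have "\<exists>x. v = (\<lambda>f. \<Sum>i<DIM('e). x i * e i p f)"
  proof (rule tangent_space_basis[OF manifold assms(1)])
    fix x assume z: "(\<lambda>f. \<Sum>i<DIM('e). x i * e i p f) = (\<lambda>f. 0)"
    have "x i = 0" if "i < 3" for i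
    proof -
      have "comb p x = comb p (\<lambda>_. 0)" using z by (simp add: dim)
      then have "g p (comb p x) (e i p) = g p (comb p (\<lambda>_. 0)) (e i p)" by (rule arg_cong)
      then have "frame_sign i * x i = frame_sign i * 0"
        unfolding metric_comb_frame[OF assms(1) that] .
      then show ?thesis by (simp add: frame_sign_def split: if_splits)
    qed
    then show "\<forall>i<DIM('e). x i = 0" by (simp add: dim)
  qed (simp_all add: assms dim frame_tangent)
  then obtain x where v: "v = comb p x" unfolding dim by blast
  have "frame_sign i * g p v (e i p) = x i" if "i < 3" for i
    using frame_sign_square[of i] by (simp add: v metric_comb_frame[OF assms(1) that] mult.assoc[symmetric])
  then show ?thesis unfolding v by (intro ext sum.cong) auto
qed

lemma metric_pseudo_riemannian: "pseudo_riemannian M g"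
proof -
  have "u = (\<lambda>f. 0)" if "p \<in> points M" "u \<in> tangent_space M p" "\<forall>v\<in>tangent_space M p. g p u v = 0"
    for p u
  proof -
    have "comb p (\<lambda>i. frame_sign i * g p u (e i p)) = (\<lambda>f. 0)"
      using that(1,3) frame_tangent by simp
    then show ?thesis using tangent_eq_comb[OF that(1,2)] by (rule trans[rotated])
  qed
  then show ?thesis using metric unfolding pseudo_riemannian_def by blast
qed

text \<open>Orthogonality to $e_0$ gives $u_1=\alpha e_1+\beta e_2$ and so $u_2=\varphi u_1=\alpha e_2-\beta e_1$.
  Then $g(u_1,u_2)=-2\alpha\beta=0$ and $g(u_1,u_1)=\alpha^2-\beta^2=1$, which leave only
  $\beta=0$ and $\alpha=\pm1$.\<close>

lemma phi_basis_unique: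
  assumes "p \<in> points M" "phi_basis M \<phi> (e 0) g p u"
  obtains s where "s = 1 \<or> s = -1" "u 0 = e 0 p" "u 1 = (\<lambda>f. s * e 1 p f)" "u 2 = (\<lambda>f. s * e 2 p f)"
proof -
  have T: "\<forall>i<3. u i \<in> tangent_space M p" and u0: "u 0 = e 0 p"
    and u2: "\<phi> p (u 1) = u 2" and u11: "g p (u 1) (u 1) = 1"
    and orth: "\<forall>i<3. \<forall>j<3. i \<noteq> j \<longrightarrow> g p (u i) (u j) = 0"
    using assms(2) unfolding phi_basis_def tbasis_def by blast+
  have u: "u 1 \<in> tangent_space M p" "u 0 = e 0 p" "\<phi> p (u 1) = u 2"
    "g p (u 1) (u 1) = 1" "g p (u 1) (u 2) = 0" "g p (u 1) (u 0) = 0"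
    using T u0 u2 u11 orth[rule_format, of 1 2] orth[rule_format, of 1 0] by simp_all
  obtain x where x: "u 1 = comb p x" by (rule that[OF tangent_eq_comb[OF assms(1) u(1)]])
  have "x 0 = 0"
    using u(6) metric_comb_frame[OF assms(1), of 0 x] unfolding u(2) x by (simp add: frame_sign_def)
  moreover have u2: "u 2 = comb p (phi_coords x)" using phi_comb[OF assms(1)] u(3) x by simp
  ultimately have q: "x 1 * x 1 - x 2 * x 2 = 1" "x 1 * x 2 = 0"
    using u(4,5) unfolding x u2 metric_comb[OF assms(1)]
    by (simp_all add: sum_lessThan_3 frame_sign_def phi_coords_def)
  have "x 2 = 0"
  proof (rule ccontr)
    assume "x 2 \<noteq> 0"
    then have "- (x 2 * x 2) = 1" using q by simp
    then show False using zero_le_square[of "x 2"] by linarith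
  qed
  then have "x 1 = 1 \<or> x 1 = -1" using q(1) by (simp add: square_eq_1_iff)
  moreover have "u 1 = (\<lambda>f. x 1 * e 1 p f)" "u 2 = (\<lambda>f. x 1 * e 2 p f)"
    unfolding x u2 using \<open>x 0 = 0\<close> \<open>x 2 = 0\<close>
    by (simp_all add: sum_lessThan_3 phi_coords_def)
  ultimately show ?thesis using that u(2) by blast
qed

lemma vfield_eq_frame:
  assumes "X \<in> vfields M"
  shows "X = (\<lambda>p f. \<Sum>i<3. (frame_sign i * g p (X p) (e i p)) * e i p f)"
proof
  fix p
  show "X p = (\<lambda>f. \<Sum>i<3. (frame_sign i * g p (X p) (e i p)) * e i p f)"
  proof (cases "p \<in> points M")
    case True
    from tangent_eq_comb[OF True vfields_tangent[OF assms True]] show ?thesis .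
  next
    case False
    then show ?thesis using vfields_outside[OF assms False] vfields_outside[OF frame False] by simp
  qed
qed

lemma frame_coefficients_smooth:
  assumes "X \<in> vfields M" "i < 3"
  shows "smooth_fun_on M (points M) (\<lambda>p. frame_sign i * g p (X p) (e i p))"
proof (rule smooth_fun_on_mult[OF manifold smooth_fun_on_const])
  show "smooth_fun_on M (points M) (\<lambda>p. g p (X p) (e i p))"
    by (rule symmetric_tensor02_rules(2)[OF metric assms(1) frame[OF assms(2)]])
qed

text \<open>The coefficients in the frame are globally smooth, so linearity over smooth functions applies to \<open>X\<close>
  and \<open>Y\<close> as they stand, without cutting off by bump functions. For \<open>Z\<close>, which is never
  differentiated, linearity at the point is enough.\<close>

lemma F_tensor_frame:
  assumes D: "affine_connection M D" and p: "p \<in> points M"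
    and XYZ: "X \<in> vfields M" "Y \<in> vfields M" "Z \<in> vfields M"
    and coords: "X p = comb p x" "Y p = comb p y" "Z p = comb p z"
  shows "F_tensor M \<phi> g D X Y Z p =
    (\<Sum>i<3. x i * (\<Sum>j<3. y j * (\<Sum>k<3. z k * F_tensor M \<phi> g D (e i) (e j) (e k) p)))"
proof -
  let ?F = "F_tensor M \<phi> g D"
  have fr: "e i \<in> vfields M \<and> smooth_fun_on M (points M) (\<lambda>p. frame_sign i * g p (W p) (e i p))"
    if "W \<in> vfields M" "i < 3" for W i
    using frame frame_coefficients_smooth that by blast
  have co: "frame_sign i * g p (W p) (e i p) = w i" if "W p = comb p w" "i < 3" for W w i
    using frame_sign_square[of i] by (simp add: that metric_comb_frame[OF p] mult.assoc[symmetric])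
  have "?F X Y Z p = (\<Sum>i<3. (frame_sign i * g p (X p) (e i p)) * ?F (e i) Y Z p)"
    by (rule trans[OF arg_cong[where f="\<lambda>W. ?F W Y Z p", OF vfield_eq_frame[OF XYZ(1)]]
          F_tensor_sum_left[where n=3 and X=e and h="\<lambda>i p. frame_sign i * g p (X p) (e i p)",
            OF manifold D phi_tensor metric XYZ(2,3) p fr[OF XYZ(1)]]])
  also have "\<dots> = (\<Sum>i<3. x i * ?F (e i) Y Z p)"
    using co[where W=X and w=x, OF coords(1)] by (intro sum.cong refl) simp
  also have "\<dots> = (\<Sum>i<3. x i * (\<Sum>j<3. y j * (\<Sum>k<3. z k * ?F (e i) (e j) (e k) p)))"
  proof (rule sum.cong[OF refl], rule arg_cong[where f="(*) _"])
    fix i :: nat assume "i \<in> {..<3}"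
    then have i: "i < 3" by simp
    have "?F (e i) Y Z p = (\<Sum>j<3. (frame_sign j * g p (Y p) (e j p)) * ?F (e i) (e j) Z p)"
      by (rule trans[OF arg_cong[where f="\<lambda>W. ?F (e i) W Z p", OF vfield_eq_frame[OF XYZ(2)]]
            F_tensor_sum_middle[where n=3 and Y=e and h="\<lambda>i p. frame_sign i * g p (Y p) (e i p)",
              OF manifold D phi_tensor metric frame[OF i] XYZ(3) p fr[OF XYZ(2)]]])
    also have "\<dots> = (\<Sum>j<3. y j * (\<Sum>k<3. z k * ?F (e i) (e j) (e k) p))"
      using co[where W=Y and w=y, OF coords(2)]
        F_tensor_sum_right[where W=Z and Z=e and n=3, OF manifold D phi_tensor metric frame[OF i] frame p
          frame coords(3)]
      by (intro sum.cong refl) simp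
    finally show "?F (e i) Y Z p = (\<Sum>j<3. y j * (\<Sum>k<3. z k * ?F (e i) (e j) (e k) p))" .
  qed
  finally show ?thesis .
qed


section \<open>The Levi-Civita connection in the frame\<close>

text \<open>As $g(e_j,e_k)$ is constant, compatibility with the metric makes $g(\nabla_{e_i}e_j,e_k)$
  skew-symmetric in \<open>j\<close> and \<open>k\<close>; its skew part in \<open>i\<close> and \<open>j\<close> is given by the bracket, since there is no
  torsion. These two symmetries determine it.\<close>

lemma koszul_frame:
  assumes LC: "levi_civita M g D" and p: "p \<in> points M" and ijk: "i < 3" "j < 3" "k < 3"
  defines "c \<equiv> \<lambda>i j k. g p (lie_bracket M (e i) (e j) p) (e k p)"
  shows "g p (D (e i) (e j) p) (e k p) = (c i j k - c j k i + c k i j) / 2"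
proof -
  have D: "affine_connection M D" using levi_civita_rules(1)[OF LC] .
  define G where "G i j k = g p (D (e i) (e j) p) (e k p)" for i j k
  have T: "D (e i) (e j) p \<in> tangent_space M p" if "i < 3" "j < 3" for i j
    using vfields_tangent[OF connection_vfields[OF D frame[OF that(1)] frame[OF that(2)]] p] .
  have skew: "G i j k = - G i k j" if "i < 3" "j < 3" "k < 3" for i j k
  proof -
    have "e i p (\<lambda>q. g q (e j q) (e k q)) = G i j k + g p (e j p) (D (e i) (e k) p)"
      unfolding G_def
      by (rule levi_civita_rules(3)[OF LC frame[OF that(1)] frame[OF that(2)] frame[OF that(3)] p])
    moreover have "e i p (\<lambda>q. g q (e j q) (e k q)) = 0"
      by (rule tangent_vector_local[OF manifold p frame_tangent[OF p that(1)]])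
        (rule orthonormal[OF _ that(2,3)])
    moreover have "g p (e j p) (D (e i) (e k) p) = G i k j"
      unfolding G_def by (rule metric_sym[OF metric p frame_tangent[OF p that(2)] T[OF that(1,3)]])
    ultimately show ?thesis by simp
  qed
  have torsion: "c i j k = G i j k - G j i k" if "i < 3" "j < 3" "k < 3" for i j k
  proof -
    have "lie_bracket M (e i) (e j) p = (\<lambda>f. 1 * D (e i) (e j) p f + (-1) * D (e j) (e i) p f)"
      unfolding levi_civita_rules(2)[OF LC frame[OF that(1)] frame[OF that(2)], symmetric] by simp
    moreover have "g p (\<lambda>f. 1 * D (e i) (e j) p f + (-1) * D (e j) (e i) p f) (e k p)
        = 1 * G i j k + (-1) * G j i k"
      unfolding G_def
      by (rule symmetric_tensor02_rules(1)[OF metric p frame_tangent[OF p that(3)]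
            T[OF that(1,2)] T[OF that(2,1)]])
    ultimately show ?thesis unfolding c_def by simp
  qed
  show ?thesis
    unfolding torsion[OF ijk] torsion[OF ijk(2,3,1)] torsion[OF ijk(3,1,2)] G_def[symmetric]
    using skew[OF ijk] skew[OF ijk(2,3,1)] skew[OF ijk(3,1,2)] by simp
qed

text \<open>Written as multiples of frame fields, also where a factor is 0 or 1, so that one rule for the
  derivative of a constant multiple covers the three cases.\<close>

lemma phi_frame_fields:
  "app11 M \<phi> (e 0) = (\<lambda>p f. 0 * e 0 p f)"
  "app11 M \<phi> (e 1) = (\<lambda>p f. 1 * e 2 p f)"
  "app11 M \<phi> (e 2) = (\<lambda>p f. - 1 * e 1 p f)"
proof -
  have "app11 M \<phi> (e 0) p = (\<lambda>f. 0 * e 0 p f)" "app11 M \<phi> (e 1) p = (\<lambda>f. 1 * e 2 p f)"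
    "app11 M \<phi> (e 2) p = (\<lambda>f. - 1 * e 1 p f)" for p
    using phi_frame[of p] vfields_outside[OF frame[of 1], of p] vfields_outside[OF frame[of 2], of p]
    by (cases "p \<in> points M"; simp add: app11_def)+
  then show "app11 M \<phi> (e 0) = (\<lambda>p f. 0 * e 0 p f)" "app11 M \<phi> (e 1) = (\<lambda>p f. 1 * e 2 p f)"
    "app11 M \<phi> (e 2) = (\<lambda>p f. - 1 * e 1 p f)"
    by (intro ext; simp only:)+
qed

text \<open>From $g(\nabla_{e_i}(\varphi e_j),e_k)-g(\varphi\nabla_{e_i}e_j,e_k)$: in the first term $\varphi$ maps the
  frame to itself up to sign, and in the second it moves to $e_k$ because it is self-adjoint.\<close>

lemma F_tensor_frame_components:
  assumes D: "affine_connection M D" and p: "p \<in> points M" and ijk: "i < 3" "j < 3" "k < 3"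
  defines "G \<equiv> \<lambda>i j k. g p (D (e i) (e j) p) (e k p)"
  shows "F_tensor M \<phi> g D (e i) (e j) (e k) p =
      (if j = 1 then G i 2 k else if j = 2 then - G i 1 k else 0)
    - (if k = 1 then G i j 2 else if k = 2 then - G i j 1 else 0)"
proof -
  let ?\<phi>e = "app11 M \<phi> (e j)"
  have DT: "D (e i) Y p \<in> tangent_space M p" if "Y \<in> vfields M" for Y
    using vfields_tangent[OF connection_vfields[OF D frame[OF ijk(1)] that] p] .
  have \<phi>T: "\<phi> p (D (e i) (e j) p) \<in> tangent_space M p"
    using tensor11_rules(1)[OF phi_tensor p DT[OF frame[OF ijk(2)]]] .
  have gl: "g p (\<lambda>f. r * v f + s * w f) (e k p) = r * g p v (e k p) + s * g p w (e k p)"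
    if "v \<in> tangent_space M p" "w \<in> tangent_space M p" for r s v w
    using symmetric_tensor02_rules(1)[OF metric p frame_tangent[OF p ijk(3)] that] .
  have "F_tensor M \<phi> g D (e i) (e j) (e k) p =
      g p (D (e i) ?\<phi>e p) (e k p) - g p (\<phi> p (D (e i) (e j) p)) (e k p)"
    using gl[OF DT[OF tensor11_rules(3)[OF phi_tensor frame[OF ijk(2)]]] \<phi>T, of 1 "-1"]
    by (simp add: F_tensor_def)
  moreover have "g p (D (e i) ?\<phi>e p) (e k p) =
      (if j = 1 then G i 2 k else if j = 2 then - G i 1 k else 0)"
  proof -
    have *: "g p (D (e i) (\<lambda>p f. c * e l p f) p) (e k p) = c * G i l k" if "l < 3" for c l
    proof -
      have "e i p (\<lambda>_. c) = 0"
        by (rule tangent_vector_local[OF manifold p frame_tangent[OF p ijk(1)]]) (rule refl)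
      then have "D (e i) (\<lambda>p f. c * e l p f) p = (\<lambda>f. c * D (e i) (e l) p f + 0 * D (e i) (e l) p f)"
        unfolding connection_scale(2)[OF D frame[OF ijk(1)] frame[OF that] smooth_fun_on_const[of M c]]
        by simp
      then show ?thesis
        using gl[OF DT[OF frame[OF that]] DT[OF frame[OF that]], of c 0] by (simp add: G_def)
    qed
    consider "j = 0" | "j = 1" | "j = 2" using less_3_cases[OF ijk(2)] by blast
    then show ?thesis
    proof cases
      case 1
      then show ?thesis using *[of 0 0] by (simp add: phi_frame_fields)
    next
      case 2
      then show ?thesis using *[of 2 1] by (simp add: phi_frame_fields(2)[unfolded One_nat_def])
    next
      case 3
      then show ?thesis using *[of 1 "-1"] by (simp add: phi_frame_fields)
    qed
  qed
  moreover have "g p (\<phi> p (D (e i) (e j) p)) (e k p) =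
      (if k = 1 then G i j 2 else if k = 2 then - G i j 1 else 0)"
  proof -
    obtain x where x: "D (e i) (e j) p = comb p x"
      by (rule that[OF tangent_eq_comb[OF p DT[OF frame[OF ijk(2)]]]])
    have "G i j l = frame_sign l * x l" if "l < 3" for l
      unfolding G_def x by (rule metric_comb_frame[OF p that])
    from this[of 1] this[of 2] have G12: "G i j 1 = x 1" "G i j 2 = - x 2"
      unfolding frame_sign_def by auto
    have "g p (\<phi> p (D (e i) (e j) p)) (e k p) = frame_sign k * phi_coords x k"
      unfolding x phi_comb[OF p] by (rule metric_comb_frame[OF p ijk(3)])
    also have "\<dots> = (if k = 1 then - x 2 else if k = 2 then - x 1 else 0)"
      by (simp add: phi_coords_def frame_sign_def)
    finally show ?thesis unfolding G12 .
  qed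
  ultimately show ?thesis by simp
qed

end


section \<open>The class of the manifold\<close>

lemma lie_bracket_skew: "lie_bracket M Y X = (\<lambda>p f. - lie_bracket M X Y p f)"
  by (auto simp: lie_bracket_def fun_eq_iff)

text \<open>The structure constants: the coefficient of $e_k$ in $[e_i,e_j]$.\<close>

definition bracket_coeff :: "real \<Rightarrow> real \<Rightarrow> real \<Rightarrow> real \<Rightarrow> nat \<Rightarrow> nat \<Rightarrow> nat \<Rightarrow> real" where
  "bracket_coeff a b c d i j k =
     (if k = 0 then (if i = 0 \<and> j = 1 then - d else if i = 1 \<and> j = 0 then d
                else if i = 0 \<and> j = 2 then c else if i = 2 \<and> j = 0 then - c else 0)
      else (if i = 1 \<and> j = 2 then 1 else if i = 2 \<and> j = 1 then -1 else 0) * (if k = 1 then a else b))"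

context adapted_frame
begin

lemma F_tensor_class:
  assumes LC: "levi_civita M g D" and p: "p \<in> points M"
    and br: "lie_bracket M (e 0) (e 1) = (\<lambda>p f. - d * e 0 p f)"
      "lie_bracket M (e 0) (e 2) = (\<lambda>p f. c * e 0 p f)"
      "lie_bracket M (e 1) (e 2) = (\<lambda>p f. a * e 1 p f + b * e 2 p f)"
    and XYZ: "X \<in> vfields M" "Y \<in> vfields M" "Z \<in> vfields M"
    and coords: "X p = comb p x" "Y p = comb p y" "Z p = comb p z"
  shows "F_tensor M \<phi> g D X Y Z p = F1_part (2 * a) (2 * b) x y z + F11_part c d x y z"
proof -
  let ?B = "bracket_coeff a b c d"
  have D: "affine_connection M D" using levi_civita_rules(1)[OF LC] .
  have self: "lie_bracket M V V = (\<lambda>p f. 0)" for V by (simp add: lie_bracket_def fun_eq_iff)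
  have bracket: "lie_bracket M (e i) (e j) p = comb p (?B i j)" if "i < 3" "j < 3" for i j
    using less_3_cases[OF that(1)] less_3_cases[OF that(2)] br
      lie_bracket_skew[of M "e 1" "e 0"] lie_bracket_skew[of M "e 2" "e 0"]
      lie_bracket_skew[of M "e 2" "e 1"]
    by (auto simp: self sum_lessThan_3 bracket_coeff_def)
  have bracket_metric: "g p (lie_bracket M (e i) (e j) p) (e k p) = frame_sign k * ?B i j k"
    if "i < 3" "j < 3" "k < 3" for i j k
    unfolding bracket[OF that(1,2)] by (rule metric_comb_frame[OF p that(3)])
  have G: "g p (D (e i) (e j) p) (e k p) =
      (frame_sign k * ?B i j k - frame_sign i * ?B j k i + frame_sign j * ?B k i j) / 2"
    if "i < 3" "j < 3" "k < 3" for i j k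
    unfolding koszul_frame[OF LC p that] bracket_metric[OF that]
      bracket_metric[OF that(2,3,1)] bracket_metric[OF that(3,1,2)] ..
  have F: "F_tensor M \<phi> g D (e i) (e j) (e k) p =
      (if i = 0 then
         (if j = 1 \<and> k = 0 \<or> j = 0 \<and> k = 1 then c
          else if j = 2 \<and> k = 0 \<or> j = 0 \<and> k = 2 then d else 0)
       else if j = k \<and> j \<noteq> 0 then (if i = 1 then 2 * a else - 2 * b) else 0)"
    if "i < 3" "j < 3" "k < 3" for i j k
    using less_3_cases[OF that(1)] less_3_cases[OF that(2)] less_3_cases[OF that(3)]
    unfolding F_tensor_frame_components[OF D p that]
    by (elim disjE) (simp_all add: G bracket_coeff_def frame_sign_def)
  show ?thesis
    unfolding F_tensor_frame[OF D p XYZ coords]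
    by (simp add: F sum_lessThan_3 F1_part_def F11_part_def algebra_simps)
qed

end

theorem theorem2p1:
  fixes a b c d :: real
    and G :: "('a, 'b) monoid_scheme"
    and M :: "('a, real ^ 3) manifold"
    and e :: "nat \<Rightarrow> 'a vfield"
    and \<phi> :: "'a \<Rightarrow> 'a tvec \<Rightarrow> 'a tvec"
    and \<xi> :: "'a vfield"
    and \<eta> :: "'a \<Rightarrow> 'a tvec \<Rightarrow> real"
    and g :: "'a \<Rightarrow> 'a tvec \<Rightarrow> 'a tvec \<Rightarrow> real"
  assumes "a * d = b * c"
    and "lie_group G M" and "connected_space (mtop M)"
    and "lie_algebra_basis G M e"
    and "lie_bracket M (e 0) (e 1) = (\<lambda>p f. - d * e 0 p f)"
    and "lie_bracket M (e 0) (e 2) = (\<lambda>p f. c * e 0 p f)"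
    and "lie_bracket M (e 1) (e 2) = (\<lambda>p f. a * e 1 p f + b * e 2 p f)"
    and "tensor11 M \<phi>" and "left_invariant11 G M \<phi>"
    and "one_form M \<eta>" and "left_invariant01 G M \<eta>"
    and "symmetric_tensor02 M g" and "left_invariant02 G M g"
    and "\<xi> = e 0"
    and "\<And>p. p \<in> carrier G \<Longrightarrow> \<phi> p (e 0 p) = (\<lambda>f. 0) \<and> \<phi> p (e 1 p) = e 2 p \<and>
           \<phi> p (e 2 p) = (\<lambda>f. - e 1 p f)"
    and "\<And>p. p \<in> carrier G \<Longrightarrow> \<eta> p (e 0 p) = 1 \<and> \<eta> p (e 1 p) = 0 \<and> \<eta> p (e 2 p) = 0"
    and "\<And>p. p \<in> carrier G \<Longrightarrow> g p (e 0 p) (e 0 p) = 1 \<and> g p (e 1 p) (e 1 p) = 1 \<and>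
           g p (e 2 p) (e 2 p) = -1"
    and "\<And>p. p \<in> carrier G \<Longrightarrow> g p (e 0 p) (e 1 p) = 0 \<and> g p (e 0 p) (e 2 p) = 0 \<and>
           g p (e 1 p) (e 2 p) = 0"
  shows "class_F1_F11 M \<phi> \<xi> \<eta> g"
proof -
  have M: "smooth_manifold M" and carrier: "points M = carrier G"
    using assms(2) unfolding lie_group_def by auto
  have e: "e i \<in> vfields M" if "i < 3" for i
    using assms(4) that unfolding lie_algebra_basis_def left_invariant_vfields_def by blast
  interpret adapted_frame M \<phi> g e
  proof
    fix p i j assume p: "p \<in> points M" and ij: "i < (3::nat)" "j < (3::nat)"
    have T: "e l p \<in> tangent_space M p" if "l < 3" for l using vfields_tangent[OF e[OF that] p] .
    show "g p (e i p) (e j p) = (if i = j then frame_sign i else 0)"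
      using less_3_cases[OF ij(1)] less_3_cases[OF ij(2)] p carrier assms(17,18)[of p]
        metric_sym[OF assms(12) p T T, of 1 0] metric_sym[OF assms(12) p T T, of 2 0]
        metric_sym[OF assms(12) p T T, of 2 1]
      by (elim disjE) (simp_all add: frame_sign_def)
  qed (use M e assms(8,12,15) carrier in \<open>auto\<close>)
  have eta_comb: "\<eta> p (comb p x) = x 0" if p: "p \<in> points M" for p x
  proof -
    have "\<eta> p (comb p x) = (\<Sum>i<3. x i * \<eta> p (e i p))"
    proof (rule tangent_linear_sum[OF M p])
      show "\<eta> p (\<lambda>f. r * v f + s * w f) = r * \<eta> p v + s * \<eta> p w"
        if "v \<in> tangent_space M p" "w \<in> tangent_space M p" for v w r s
        using assms(10) p that unfolding one_form_def by blast
    qed (rule frame_tangent[OF p])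
    then show ?thesis using assms(16) p carrier by (simp add: sum_lessThan_3)
  qed
  have compat: "\<phi> p (\<phi> p v) = (\<lambda>f. - v f + \<eta> p v * e 0 p f)" "\<eta> p (\<phi> p v) = 0"
    "g p (\<phi> p v) (\<phi> p w) = - g p v w + \<eta> p v * \<eta> p w"
    if p: "p \<in> points M" and vw: "v \<in> tangent_space M p" "w \<in> tangent_space M p" for p v w
  proof -
    obtain x y where xy: "v = comb p x" "w = comb p y"
      by (rule that[OF tangent_eq_comb[OF p vw(1)] tangent_eq_comb[OF p vw(2)]])
    show "\<phi> p (\<phi> p v) = (\<lambda>f. - v f + \<eta> p v * e 0 p f)"
      unfolding xy phi_comb[OF p] eta_comb[OF p] by (simp add: sum_lessThan_3 phi_coords_def)
    show "\<eta> p (\<phi> p v) = 0"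
      unfolding xy phi_comb[OF p] eta_comb[OF p] by (simp add: phi_coords_def)
    show "g p (\<phi> p v) (\<phi> p w) = - g p v w + \<eta> p v * \<eta> p w"
      unfolding xy phi_comb[OF p] eta_comb[OF p] metric_comb[OF p]
      by (simp add: sum_lessThan_3 phi_coords_def frame_sign_def)
  qed
  have acb: "almost_contact_B_metric M \<phi> \<xi> \<eta> g"
    unfolding almost_contact_B_metric_def assms(14)
  proof (intro conjI ballI)
    show "\<exists>n. DIM(real ^ 3) = 2 * n + 1" by (rule exI[of _ 1]) simp
    show "\<phi> p (e 0 p) = (\<lambda>f. 0)" "\<eta> p (e 0 p) = 1" if "p \<in> points M" for p
      using that carrier assms(15,16) by auto
  qed (use M e[of 0] assms(8,10) metric_pseudo_riemannian compat in auto)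
  have cls: "\<exists>\<theta>1 \<theta>2 \<omega>1 \<omega>2.
      (let Fc = (\<lambda>i j k. F_tensor M \<phi> g D (E i) (E j) (E k) p) in
       \<theta>1 = Fc 1 1 1 \<and> \<theta>1 = Fc 1 2 2 \<and> \<theta>2 = - Fc 2 1 1 \<and> \<theta>2 = - Fc 2 2 2 \<and>
       \<omega>1 = Fc 0 1 0 \<and> \<omega>1 = Fc 0 0 1 \<and> \<omega>2 = Fc 0 2 0 \<and> \<omega>2 = Fc 0 0 2) \<and>
      (\<forall>X \<in> vfields M. \<forall>Y \<in> vfields M. \<forall>Z \<in> vfields M. \<forall>x y z.
         X p = (\<lambda>f. \<Sum>i<3. x i * E i p f) \<and> Y p = (\<lambda>f. \<Sum>i<3. y i * E i p f) \<and>
         Z p = (\<lambda>f. \<Sum>i<3. z i * E i p f) \<longrightarrow>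
         F_tensor M \<phi> g D X Y Z p = F1_part \<theta>1 \<theta>2 x y z + F11_part \<omega>1 \<omega>2 x y z)"
    if LC: "levi_civita M g D" and p: "p \<in> points M" and E: "\<forall>i<3. E i \<in> vfields M"
      and basis: "phi_basis M \<phi> \<xi> g p (\<lambda>i. E i p)" for D p E
  proof -
    obtain s where s: "s = 1 \<or> s = -1" and
      Es: "E 0 p = e 0 p" "E 1 p = (\<lambda>f. s * e 1 p f)" "E 2 p = (\<lambda>f. s * e 2 p f)"
      using phi_basis_unique[OF p] basis unfolding assms(14) by metis
    \<comment> \<open>The change of coordinates from \<open>E\<close> to the frame. Both parts of \<open>F\<close> are of odd degree in the
      coordinates that it multiplies by \<open>s\<close>, so that a factor \<open>s\<close> comes out.\<close>
    define t where "t x i = (if i = 0 then 1 else s) * x i" for x :: "nat \<Rightarrow> real" and i :: nat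
    have comb_E: "(\<lambda>f. \<Sum>i<3. x i * E i p f) = comb p (t x)" for x
      using Es by (simp add: sum_lessThan_3 t_def mult_ac)
    have F: "F_tensor M \<phi> g D X Y Z p
        = F1_part (s * (2 * a)) (s * (2 * b)) x y z + F11_part (s * c) (s * d) x y z"
      if "X \<in> vfields M" "Y \<in> vfields M" "Z \<in> vfields M"
        "X p = (\<lambda>f. \<Sum>i<3. x i * E i p f)" "Y p = (\<lambda>f. \<Sum>i<3. y i * E i p f)"
        "Z p = (\<lambda>f. \<Sum>i<3. z i * E i p f)" for X Y Z x y z
      using F_tensor_class[OF LC p assms(5-7) that(1-3), of "t x" "t y" "t z"] s
      unfolding that(4-6) comb_E by (auto simp: t_def F1_part_def F11_part_def algebra_simps)
    \<comment> \<open>The coordinates of \<open>E i\<close> with respect to \<open>E\<close> itself.\<close>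
    define \<delta> where "\<delta> i j = (if i = j then 1 else (0::real))" for i j :: nat
    have unit: "E i p = (\<lambda>f. \<Sum>j<3. \<delta> i j * E j p f)" if "i < 3" for i
      using less_3_cases[OF that] by (auto simp: sum_lessThan_3 \<delta>_def)
    have Fc: "F_tensor M \<phi> g D (E i) (E j) (E k) p
        = F1_part (s * (2 * a)) (s * (2 * b)) (\<delta> i) (\<delta> j) (\<delta> k)
          + F11_part (s * c) (s * d) (\<delta> i) (\<delta> j) (\<delta> k)"
      if "i < 3" "j < 3" "k < 3" for i j k
      using E that by (intro F[where x="\<delta> i" and y="\<delta> j" and z="\<delta> k"] unit) simp_all
    show ?thesis
      by (rule exI[of _ "s * (2 * a)"], rule exI[of _ "s * (2 * b)"],
          rule exI[of _ "s * c"], rule exI[of _ "s * d"])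
        (auto simp: Let_def Fc F F1_part_def[of _ _ "\<delta> _"] F11_part_def[of _ _ "\<delta> _"] \<delta>_def)
  qed
  show ?thesis
    unfolding class_F1_F11_def
  proof (intro conjI allI ballI impI)
    show "DIM(real ^ 3) = 3" by simp
  qed (rule acb, elim conjE, rule cls)
qed

end
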